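(* Let either $r=1$ and $k=0$, or $r=2$ and $k\in\{0,1\}$, and let $\mathscr{R}=\mathscr{L}$ or $\mathscr{R}=\mathscr{O}$. Then, for every $\delta\geqslant 0$, \[ \Omega(\delta)=\mathcal{E}_\delta\left(\mathscr{R};D^k;W^r_2\right)=\Omega_{-1}(\delta). \]
   Context: Let $\mathbb{I}=[-1,1]$, $L_2=L_2(\mathbb{I})$ and $L_\infty=L_\infty(\mathbb{I})$ (real-valued functions) with the usual norms $\|f\|_2=\left(\int_{-1}^1|f(x)|^2\,dx\right)^{1/2}$ and $\|f\|_\infty=\operatorname{ess\,sup}_{x\in\mathbb{I}}|f(x)|$. $L_2^r$ is the space of functions $f:\mathbb{I}\to\mathbb{R}$ having absolutely continuous derivative $f^{(r-1)}$ and such that $f^{(r)}\in L_2$. Let $W^r_2=\{f\in L_2^r:\|f^{(r)}\|_2\leqslant 1\}$. $D^k$ is the operator $f\mapsto f^{(k)}$ (from $L_2$ to $L_\infty$, with domain $L_2^r$). Define, for $\delta\geqslant0$, \[ \Omega(\delta)=\Omega(\delta;D^k;W^r_2)=\sup\{\|f^{(k)}\|_\infty: f\in W^r_2,\ \|f\|_2\leqslant\delta\}, \] \[ \Omega_{-1}(\delta)=\sup\{|f^{(k)}(-1)|: f\in W^r_2,\ \|f\|_2\leqslant\delta\}. \] Optimal recovery: $\mathscr{L}$ is the set of all linear operators $S:L_2\to L_\infty$ and $\mathscr{O}$ is the set of all mappings $S:L_2\to L_\infty$. For $\mathscr{R}\in\{\mathscr{L},\mathscr{O}\}$, \[ \mathcal{E}_\delta(\mathscr{R};D^k;W^r_2)=\inf_{S\in\mathscr{R}}\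 \sup\{\|f^{(k)}-Sg\|_\infty: f\in W^r_2,\ g\in L_2,\ \|f-g\|_2\leqslant\delta\}. \] *)

theory Defs
  imports "HOL-Analysis.Analysis" "HOL-Probability.Essential_Supremum"
begin

text \<open>
  Functions on \<open>[-1,1]\<close> are functions \<^typ>\<open>real \<Rightarrow> real\<close> whose values outside the interval are
  never inspected. Elements of \<open>L\<^sub>2\<close> and \<open>L\<^sub>\<infinity>\<close> are given by representatives; identity in these
  spaces is equality almost everywhere.
\<close>

abbreviation lebI :: "real measure" where
  "lebI \<equiv> lebesgue_on {-1..1}"

definition L2 :: "(real \<Rightarrow> real) set" where
  "L2 = {f. f \<in> borel_measurable lebI \<and> integrable lebI (\<lambda>x. (f x)\<^sup>2)}"

definition norm2 :: "(real \<Rightarrow> real) \<Rightarrow> real" where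
  "norm2 f = sqrt (\<integral>x. \<bar>f x\<bar>\<^sup>2 \<partial>lebI)"

definition norm_inf :: "(real \<Rightarrow> real) \<Rightarrow> ennreal" where
  "norm_inf f = esssup lebI (\<lambda>x. ennreal \<bar>f x\<bar>)"

definition Linf :: "(real \<Rightarrow> real) set" where
  "Linf = {f. f \<in> borel_measurable lebI \<and> norm_inf f < \<infinity>}"

definition abs_cont_on :: "real \<Rightarrow> real \<Rightarrow> (real \<Rightarrow> real) \<Rightarrow> bool" where
  "abs_cont_on a b f \<longleftrightarrow>
     (\<forall>\<epsilon>>0. \<exists>\<eta>>0. \<forall>(n::nat) u v.
        (\<forall>i<n. a \<le> u i \<and> u i \<le> v i \<and> v i \<le> b) \<and>
        disjoint_family_on (\<lambda>i. {u i<..<v i}) {..<n} \<and>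
        (\<Sum>i<n. v i - u i) < \<eta>
        \<longrightarrow> (\<Sum>i<n. \<bar>f (v i) - f (u i)\<bar>) < \<epsilon>)"

text \<open>The \<open>j\<close>-th derivative on \<open>[-1,1]\<close>, one-sided at the end points.\<close>

definition derivI :: "nat \<Rightarrow> (real \<Rightarrow> real) \<Rightarrow> real \<Rightarrow> real" where
  "derivI j = ((\<lambda>f x. vector_derivative f (at x within {-1..1})) ^^ j)"

text \<open>
  Meant for \<open>r \<ge> 1\<close>. The clause on differentiability almost everywhere follows from absolute
  continuity; it is part of the meaning of \<open>f\<^sup>(\<^sup>r\<^sup>) \<in> L\<^sub>2\<close>, since \<^const>\<open>vector_derivative\<close> is
  unspecified where the derivative does not exist.
\<close>

definition L2r :: "nat \<Rightarrow> (real \<Rightarrow> real) set" where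
  "L2r r = {f. (\<forall>j<r - 1. derivI j f differentiable_on {-1..1}) \<and>
               abs_cont_on (-1) 1 (derivI (r - 1) f) \<and>
               (AE x in lebI. derivI (r - 1) f differentiable (at x within {-1..1})) \<and>
               derivI r f \<in> L2}"

definition W2 :: "nat \<Rightarrow> (real \<Rightarrow> real) set" where
  "W2 r = {f \<in> L2r r. norm2 (derivI r f) \<le> 1}"

definition Omega :: "nat \<Rightarrow> nat \<Rightarrow> real \<Rightarrow> ennreal" where
  "Omega k r \<delta> = (SUP f\<in>{f \<in> W2 r. norm2 f \<le> \<delta>}. norm_inf (derivI k f))"

definition Omega_left :: "nat \<Rightarrow> nat \<Rightarrow> real \<Rightarrow> ennreal" where
  "Omega_left k r \<delta> = (SUP f\<in>{f \<in> W2 r. norm2 f \<le> \<delta>}. ennreal \<bar>derivI k f (-1)\<bar>)"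

text \<open>
  Maps \<open>L\<^sub>2 \<rightarrow> L\<^sub>\<infinity>\<close> act on representatives and must be compatible with equality almost everywhere.
  Linear operators are not required to be bounded.
\<close>

definition all_maps :: "((real \<Rightarrow> real) \<Rightarrow> real \<Rightarrow> real) set" where
  "all_maps = {S. (\<forall>g\<in>L2. S g \<in> Linf) \<and>
     (\<forall>g\<in>L2. \<forall>h\<in>L2. (AE x in lebI. g x = h x) \<longrightarrow> (AE x in lebI. S g x = S h x))}"

definition linear_maps :: "((real \<Rightarrow> real) \<Rightarrow> real \<Rightarrow> real) set" where
  "linear_maps = {S \<in> all_maps. \<forall>g\<in>L2. \<forall>h\<in>L2. \<forall>a b.
     AE x in lebI. S (\<lambda>y. a * g y + b * h y) x = a * S g x + b * S h x}"

definition recovery_error ::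
  "((real \<Rightarrow> real) \<Rightarrow> real \<Rightarrow> real) set \<Rightarrow> nat \<Rightarrow> nat \<Rightarrow> real \<Rightarrow> ennreal" where
  "recovery_error R k r \<delta> =
     (INF S\<in>R. SUP (f, g)\<in>{(f, g). f \<in> W2 r \<and> g \<in> L2 \<and> norm2 (\<lambda>x. f x - g x) \<le> \<delta>}.
        norm_inf (\<lambda>x. derivI k f x - S g x))"

end

theory Submission
  imports Defs "HOL-Real_Asymp.Real_Asymp"
begin

text \<open>
  For \<open>\<lambda> > 0\<close> and \<open>t \<in> [-1,1]\<close> let \<open>w\<^sub>t\<close> represent the functional \<open>f \<mapsto> f\<^sup>(\<^sup>k\<^sup>)(t)\<close> with respect to the inner
  product \<open>\<langle>f,g\<rangle> + \<lambda>\<langle>f\<^sup>(\<^sup>r\<^sup>),g\<^sup>(\<^sup>r\<^sup>)\<rangle>\<close>; it is a Green function with natural boundary conditions. The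
  linear method \<open>(Sg)(t) = \<langle>g,w\<^sub>t\<rangle>\<close> has error \<open>\<langle>f-g,w\<^sub>t\<rangle> + \<lambda>\<langle>f\<^sup>(\<^sup>r\<^sup>),w\<^sub>t\<^sup>(\<^sup>r\<^sup>)\<rangle>\<close>, whose square is at most
  \<open>w\<^sub>t\<^sup>(\<^sup>k\<^sup>)(t) (\<delta>\<^sup>2 + \<lambda>)\<close> by Cauchy-Schwarz. In the three cases at hand the explicit formulas show that
  \<open>w\<^sub>t\<^sup>(\<^sup>k\<^sup>)(t)\<close> is largest at the end points; write \<open>\<phi>(\<lambda>)\<close> for that value. It remains to see that
  \<open>\<phi>(\<lambda>) (\<delta>\<^sup>2 + \<lambda>)\<close> is attained by \<open>\<Omega>\<^sub>-\<^sub>1(\<delta>)\<^sup>2\<close> for some \<open>\<lambda>\<close>: at a minimizer, \<open>\<parallel>w\<parallel> = \<delta> \<parallel>w\<^sup>(\<^sup>r\<^sup>)\<parallel>\<close> for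
  \<open>w = w\<^sub>-\<^sub>1\<close>, so \<open>w\<close> scaled to \<open>\<parallel>w\<^sup>(\<^sup>r\<^sup>)\<parallel> = 1\<close> is extremal. The parameter \<open>c\<close> below is \<open>\<lambda>\<^sup>-\<^sup>1\<^sup>/\<^sup>2\<close> for
  \<open>r = 1\<close> and \<open>(4\<lambda>)\<^sup>-\<^sup>1\<^sup>/\<^sup>4\<close> for \<open>r = 2\<close>.
\<close>

section \<open>Absolutely continuous functions\<close>

text \<open>Carries the definition over to tagged partial divisions, the form a gauge argument
  needs. The cells of \<open>q\<close> do not overlap and lie in \<open>T\<close>, so their total
  length is at most the measure of \<open>T\<close>, hence below \<open>\<eta>\<close>.\<close>

lemma abs_cont_on_division_sum:
  assumes ac: "abs_cont_on a b F" and "\<epsilon> > 0"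
  obtains \<eta> where "\<eta> > 0" and "\<And>q T. q tagged_partial_division_of {a..b} \<Longrightarrow> T \<in> sets lebesgue
           \<Longrightarrow> emeasure lebesgue T < ennreal \<eta> \<Longrightarrow> (\<forall>(x, K)\<in>q. K \<subseteq> T)
         \<Longrightarrow> (\<Sum>(x, K)\<in>q. \<bar>F (Sup K) - F (Inf K)\<bar>) < \<epsilon>"
proof -
  obtain \<eta> where "\<eta> > 0" and \<eta>: "\<forall>(n::nat) u v. (\<forall>i<n. a \<le> u i \<and> u i \<le> v i \<and> v i \<le> b) \<and>
        disjoint_family_on (\<lambda>i. {u i<..<v i}) {..<n} \<and> (\<Sum>i<n. v i - u i) < \<eta>
        \<longrightarrow> (\<Sum>i<n. \<bar>F (v i) - F (u i)\<bar>) < \<epsilon>"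
    using mp[OF spec[OF ac[unfolded abs_cont_on_def], of \<epsilon>] \<open>\<epsilon> > 0\<close>] by (elim exE conjE) (rule that)
  have "(\<Sum>(x, K)\<in>q. \<bar>F (Sup K) - F (Inf K)\<bar>) < \<epsilon>"
    if q: "q tagged_partial_division_of {a..b}" and T: "T \<in> sets lebesgue" "emeasure lebesgue T < ennreal \<eta>"
      and sub: "\<forall>(x, K)\<in>q. K \<subseteq> T" for q T
  proof -
    have "finite q" using tagged_partial_division_ofD(1)[OF q] .
    then obtain h where h: "bij_betw h {..<card q} q"
      using ex_bij_betw_nat_finite[of q] by (auto simp: atLeast0LessThan)
    define n where "n = card q"
    define u where "u = (\<lambda>i. Inf (snd (h i)))"
    define v where "v = (\<lambda>i. Sup (snd (h i)))"
    have hq: "h i \<in> q" if "i < n" for i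
      using h that unfolding bij_betw_def n_def by auto
    have K: "snd (h i) = {u i..v i} \<and> a \<le> u i \<and> u i \<le> v i \<and> v i \<le> b" if "i < n" for i
    proof -
      obtain x K where xK: "h i = (x, K)" by fastforce
      then have "(x, K) \<in> q" using hq[OF that] by simp
      then obtain \<alpha> \<beta> where "K = {\<alpha>..\<beta>}" "x \<in> K" "K \<subseteq> {a..b}"
        using tagged_partial_division_ofD[OF q] by (metis box_real(2))
      then show ?thesis unfolding u_def v_def xK by auto
    qed
    have disj: "disjoint_family_on (\<lambda>i. {u i<..<v i}) {..<n}"
      unfolding disjoint_family_on_def
    proof (intro ballI impI)
      fix i j assume "i \<in> {..<n}" "j \<in> {..<n}" and "i \<noteq> j"
      then have ij: "i < n" "j < n" "i \<noteq> j" by auto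
      then have ne: "h i \<noteq> h j"
        using h unfolding bij_betw_def n_def by (auto dest: inj_onD)
      have "interior (snd (h i)) \<inter> interior (snd (h j)) = {}"
        using tagged_partial_division_ofD(5)[OF q, of "fst (h i)" "snd (h i)" "fst (h j)" "snd (h j)"]
          ne hq ij by simp
      then show "{u i<..<v i} \<inter> {u j<..<v j} = {}"
        using K ij by simp
    qed
    have "ennreal (\<Sum>i<n. v i - u i) = (\<Sum>i<n. ennreal (v i - u i))"
      using K by (intro sum_ennreal[symmetric]) simp
    also have "\<dots> = (\<Sum>i<n. emeasure lebesgue {u i<..<v i})"
      using K by (intro sum.cong) auto
    also have "\<dots> = emeasure lebesgue (\<Union>i<n. {u i<..<v i})"
      by (intro sum_emeasure disj) auto
    also have "\<dots> \<le> emeasure lebesgue T"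
    proof (intro emeasure_mono T)
      show "(\<Union>i<n. {u i<..<v i}) \<subseteq> T"
      proof clarify
        fix i x assume "i < n" "x \<in> {u i<..<v i}"
        then have "x \<in> snd (h i)" using K[of i] by simp
        then show "x \<in> T" using sub hq[OF \<open>i < n\<close>] by (auto simp: case_prod_beta)
      qed
    qed
    finally have "ennreal (\<Sum>i<n. v i - u i) < ennreal \<eta>"
      using T by simp
    then have "(\<Sum>i<n. v i - u i) < \<eta>"
      using K by (subst (asm) ennreal_less_iff) (auto intro!: sum_nonneg)
    then have "(\<Sum>i<n. \<bar>F (v i) - F (u i)\<bar>) < \<epsilon>"
      using K disj by (intro \<eta>[rule_format]) auto
    moreover have "(\<Sum>i<n. \<bar>F (v i) - F (u i)\<bar>) = (\<Sum>(x, K)\<in>q. \<bar>F (Sup K) - F (Inf K)\<bar>)"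
      unfolding u_def v_def n_def
      using sum.reindex_bij_betw[OF h, of "\<lambda>(x, K). \<bar>F (Sup K) - F (Inf K)\<bar>"] by (simp add: case_prod_beta)
    ultimately show ?thesis by simp
  qed
  with \<open>\<eta> > 0\<close> show thesis by (rule that)
qed

text \<open>A gauge argument in two parts. Cells tagged outside \<open>N\<close> are controlled by
  differentiability at the tag; cells tagged in \<open>N\<close> lie in an open set of small
  measure, where absolute continuity makes the sum of the increments of \<open>F\<close>
  small.\<close>

theorem abs_cont_on_has_integral_derivative:
  fixes F f :: "real \<Rightarrow> real"
  assumes "a \<le> b" and ac: "abs_cont_on a b F" and N: "negligible N"
    and der: "\<And>x. x \<in> {a..b} - N \<Longrightarrow> (F has_vector_derivative f x) (at x within {a..b})"
  shows "(f has_integral (F b - F a)) {a..b}"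
proof -
  \<comment> \<open>With value 0 on \<open>N\<close>, a cell tagged in \<open>N\<close> contributes
    only its increment of \<open>F\<close>.\<close>
  define g where "g = (\<lambda>x. if x \<in> N then 0 else f x)"
  have "(g has_integral (F b - F a)) (cbox a b)"
    unfolding has_integral
  proof (intro allI impI)
    fix e :: real assume "e > 0"
    \<comment> \<open>Chosen so that \<open>e' * (b - a) < e / 2\<close>; the summand 1 covers the
      case \<open>a = b\<close>.\<close>
    define e' where "e' = e / (2 * (b - a + 1))"
    have "e' > 0" using \<open>e > 0\<close> \<open>a \<le> b\<close> by (simp add: e'_def)
    have "\<forall>x. \<exists>d>0. x \<in> {a..b} - N \<longrightarrow>
         (\<forall>y\<in>{a..b}. norm (y-x) < d \<longrightarrow> norm (F y - F x - (y-x) *\<^sub>R f x) \<le> e' * norm (y-x))"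
      using der[unfolded has_vector_derivative_def has_derivative_within_alt] \<open>e' > 0\<close>
      by (metis zero_less_one)
    then obtain d where d: "\<And>x. 0 < d x"
                 "\<And>x y. \<lbrakk>x \<in> {a..b} - N; y \<in> {a..b}; \<bar>y-x\<bar> < d x\<rbrakk>
                        \<Longrightarrow> \<bar>F y - F x - (y-x) * f x\<bar> \<le> e' * \<bar>y-x\<bar>"
      unfolding real_norm_def real_scaleR_def by metis
    obtain \<eta> where "\<eta> > 0" and \<eta>: "\<And>q T. q tagged_partial_division_of {a..b} \<Longrightarrow> T \<in> sets lebesgue
           \<Longrightarrow> emeasure lebesgue T < ennreal \<eta> \<Longrightarrow> (\<forall>(x, K)\<in>q. K \<subseteq> T)
         \<Longrightarrow> (\<Sum>(x, K)\<in>q. \<bar>F (Sup K) - F (Inf K)\<bar>) < e / 2"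
      by (rule abs_cont_on_division_sum[OF ac, of "e / 2"]) (use \<open>e > 0\<close> in auto)
    have Nl: "N \<in> sets lebesgue" "emeasure lebesgue N = 0"
      using N by (auto simp: negligible_iff_null_sets)
    obtain T where T: "open T" "N \<subseteq> T" "T - N \<in> lmeasurable" "emeasure lebesgue (T - N) < ennreal \<eta>"
      using sets_lebesgue_outer_open[OF Nl(1) \<open>\<eta> > 0\<close>] by metis
    have Ts: "T \<in> sets lebesgue" using T by simp
    have "emeasure lebesgue T = emeasure lebesgue (T - N)"
      using Nl Ts by (simp add: emeasure_Diff_null_set null_setsI)
    then have Tm: "emeasure lebesgue T < ennreal \<eta>" using T by simp
    \<comment> \<open>A tag in \<open>N\<close> forces its whole cell into \<open>T\<close>, so
      those cells have total length below \<open>\<eta>\<close>.\<close>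
    define \<gamma> where "\<gamma> = (\<lambda>x. if x \<in> N then T else ball x (d x))"
    have gauge: "gauge \<gamma>"
      unfolding gauge_def \<gamma>_def using T d by auto
    have close: "norm ((\<Sum>(x, K)\<in>p. measure lborel K *\<^sub>R g x) - (F b - F a)) < e"
      if ptag: "p tagged_division_of cbox a b" and fine: "\<gamma> fine p" for p
    proof -
      have fin: "finite p" using ptag by blast
      have tp: "p tagged_partial_division_of {a..b}"
        using ptag by (simp add: tagged_division_of_def)
      have ba: "b - a = (\<Sum>(x,K)\<in>p. Sup K - Inf K)" "F b - F a = (\<Sum>(x,K)\<in>p. F(Sup K) - F(Inf K))"
        using additive_tagged_division_1[where f= "\<lambda>x. x"] additive_tagged_division_1[where f= F]
            \<open>a \<le> b\<close> ptag by auto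
      have Kint: "\<exists>u v. K = {u..v} \<and> u \<le> v \<and> x \<in> {u..v} \<and> {u..v} \<subseteq> {a..b}" if xKp: "(x, K) \<in> p" for x K
      proof -
        obtain u v where "K = cbox u v" using tagged_partial_division_ofD(4)[OF tp xKp] by blast
        then show ?thesis using tagged_partial_division_ofD(2,3)[OF tp xKp] by fastforce
      qed
      define q where "q = {xK \<in> p. fst xK \<in> N}"
      have qp: "q \<subseteq> p" by (auto simp: q_def)
      have "(\<Sum>(x, K)\<in>q. \<bar>F (Sup K) - F (Inf K)\<bar>) < e / 2"
      proof (rule \<eta>[OF _ Ts Tm])
        show "q tagged_partial_division_of {a..b}"
          using tp qp by (rule tagged_partial_division_subset)
        show "\<forall>(x, K)\<in>q. K \<subseteq> T"
          using fine unfolding fine_def \<gamma>_def q_def by fastforce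
      qed
      moreover have "(\<Sum>(x, K)\<in>q. \<bar>measure lborel K * g x - (F (Sup K) - F (Inf K))\<bar>) = (\<Sum>(x, K)\<in>q. \<bar>F (Sup K) - F (Inf K)\<bar>)"
        by (rule sum.cong) (auto simp: q_def g_def abs_minus_commute)
      moreover have "(\<Sum>(x, K)\<in>p-q. \<bar>measure lborel K * g x - (F (Sup K) - F (Inf K))\<bar>) \<le> (\<Sum>(x, K)\<in>p-q. e' * (Sup K - Inf K))"
      proof (rule sum_mono, clarify)
        fix x K assume xK: "(x, K) \<in> p" "(x, K) \<notin> q"
        obtain u v where K: "K = {u..v}" "u \<le> v" "x \<in> {u..v}" "{u..v} \<subseteq> {a..b}"
          using Kint[OF xK(1)] by blast
        have xN: "x \<notin> N" using xK by (auto simp: q_def)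
        have "K \<subseteq> ball x (d x)"
          using fine xK(1) xN unfolding fine_def \<gamma>_def by fastforce
        moreover have "u \<in> K" "v \<in> K" using K by auto
        ultimately have "u \<in> ball x (d x)" "v \<in> ball x (d x)" by blast+
        then have "\<bar>u - x\<bar> < d x" "\<bar>v - x\<bar> < d x" by (auto simp: dist_real_def)
        then have *: "\<bar>F u - F x - (u-x) * f x\<bar> \<le> e' * \<bar>u-x\<bar>" "\<bar>F v - F x - (v-x) * f x\<bar> \<le> e' * \<bar>v-x\<bar>"
          using d(2)[of x u] d(2)[of x v] K xN by auto
        \<comment> \<open>The tag lies between \<open>u\<close> and \<open>v\<close>, so the two
          linearization errors add up to a multiple of \<open>v - u\<close>.\<close>
        have "\<bar>measure lborel K * g x - (F (Sup K) - F (Inf K))\<bar> = \<bar>(F u - F x - (u-x) * f x) - (F v - F x - (v-x) * f x)\<bar>"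
          using K xN by (simp add: g_def algebra_simps)
        also have "\<dots> \<le> e' * \<bar>u-x\<bar> + e' * \<bar>v-x\<bar>"
          using * by linarith
        also have "\<dots> = e' * (Sup K - Inf K)"
          using K by (simp add: algebra_simps)
        finally show "\<bar>measure lborel K * g x - (F (Sup K) - F (Inf K))\<bar> \<le> e' * (Sup K - Inf K)" .
      qed
      moreover have "(\<Sum>(x, K)\<in>p-q. e' * (Sup K - Inf K)) \<le> (\<Sum>(x, K)\<in>p. e' * (Sup K - Inf K))"
      proof (rule sum_mono2[OF fin])
        fix xK assume "xK \<in> p - (p - q)"
        then show "0 \<le> (case xK of (x, K) \<Rightarrow> e' * (Sup K - Inf K))"
          using Kint[of "fst xK" "snd xK"] \<open>e' > 0\<close> by (auto split: prod.splits)
      qed auto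
      moreover have "(\<Sum>(x, K)\<in>p. e' * (Sup K - Inf K)) = e' * (b - a)"
        unfolding ba(1) by (simp add: sum_distrib_left case_prod_beta)
      moreover have "e' * (b - a) < e / 2"
        using \<open>e > 0\<close> \<open>a \<le> b\<close> by (simp add: e'_def field_simps)
      moreover have "(\<Sum>(x, K)\<in>p. \<bar>measure lborel K * g x - (F (Sup K) - F (Inf K))\<bar>)
          = (\<Sum>(x, K)\<in>p-q. \<bar>measure lborel K * g x - (F (Sup K) - F (Inf K))\<bar>) + (\<Sum>(x, K)\<in>q. \<bar>measure lborel K * g x - (F (Sup K) - F (Inf K))\<bar>)"
        by (rule sum.subset_diff[OF qp fin])
      moreover have "\<bar>(\<Sum>(x, K)\<in>p. measure lborel K * g x) - (F b - F a)\<bar> \<le> (\<Sum>(x, K)\<in>p. \<bar>measure lborel K * g x - (F (Sup K) - F (Inf K))\<bar>)"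
      proof -
        have "(\<Sum>(x, K)\<in>p. measure lborel K * g x) - (F b - F a) = (\<Sum>(x, K)\<in>p. measure lborel K * g x - (F (Sup K) - F (Inf K)))"
          unfolding ba(2) by (simp add: sum_subtractf case_prod_beta)
        then show ?thesis
          using sum_abs[of "\<lambda>(x, K). measure lborel K * g x - (F (Sup K) - F (Inf K))" p] by (simp add: case_prod_beta)
      qed
      ultimately show ?thesis by simp
    qed
    show "\<exists>\<gamma>. gauge \<gamma> \<and> (\<forall>\<D>. \<D> tagged_division_of cbox a b \<and> \<gamma> fine \<D> \<longrightarrow>
        norm ((\<Sum>(x, K)\<in>\<D>. measure lborel K *\<^sub>R g x) - (F b - F a)) < e)"
      by (intro exI[of _ \<gamma>] conjI allI impI gauge) (elim conjE, rule close)
  qed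
  then have "(g has_integral (F b - F a)) {a..b}" by simp
  then show ?thesis
    by (rule has_integral_spike[OF N, rotated]) (auto simp: g_def)
qed

section \<open>Closure properties of absolute continuity\<close>

text \<open>The common source of the closure properties: restriction, Lipschitz functions,
  differences, multiples and products each reduce to a bound on single increments.\<close>

lemma abs_cont_on_dominated:
  assumes f: "abs_cont_on a b f" and g: "abs_cont_on a b g" and "a \<le> a'" "b' \<le> b"
    and dom: "\<And>u v. a' \<le> u \<Longrightarrow> u \<le> v \<Longrightarrow> v \<le> b' \<Longrightarrow> \<bar>h v - h u\<bar> \<le> M * (\<bar>f v - f u\<bar> + \<bar>g v - g u\<bar>)"
  shows "abs_cont_on a' b' h"
  unfolding abs_cont_on_def
proof (intro allI impI)
  fix \<epsilon> :: real assume "\<epsilon> > 0"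
  \<comment> \<open>\<open>M\<close> may be zero or negative, while the choice of
    \<open>\<epsilon>'\<close> divides by the constant.\<close>
  define M' where "M' = \<bar>M\<bar> + 1"
  have "M' > 0" by (simp add: M'_def)
  define \<epsilon>' where "\<epsilon>' = \<epsilon> / (2 * M')"
  have "\<epsilon>' > 0" using \<open>\<epsilon> > 0\<close> \<open>M' > 0\<close> by (simp add: \<epsilon>'_def)
  obtain \<eta>1 where "\<eta>1 > 0" and \<eta>1: "\<forall>(n::nat) u v. (\<forall>i<n. a \<le> u i \<and> u i \<le> v i \<and> v i \<le> b) \<and>
        disjoint_family_on (\<lambda>i. {u i<..<v i}) {..<n} \<and> (\<Sum>i<n. v i - u i) < \<eta>1
        \<longrightarrow> (\<Sum>i<n. \<bar>f (v i) - f (u i)\<bar>) < \<epsilon>'"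
    using mp[OF spec[OF f[unfolded abs_cont_on_def], of \<epsilon>'] \<open>\<epsilon>' > 0\<close>] by (elim exE conjE) (rule that)
  obtain \<eta>2 where "\<eta>2 > 0" and \<eta>2: "\<forall>(n::nat) u v. (\<forall>i<n. a \<le> u i \<and> u i \<le> v i \<and> v i \<le> b) \<and>
        disjoint_family_on (\<lambda>i. {u i<..<v i}) {..<n} \<and> (\<Sum>i<n. v i - u i) < \<eta>2
        \<longrightarrow> (\<Sum>i<n. \<bar>g (v i) - g (u i)\<bar>) < \<epsilon>'"
    using mp[OF spec[OF g[unfolded abs_cont_on_def], of \<epsilon>'] \<open>\<epsilon>' > 0\<close>] by (elim exE conjE) (rule that)
  have "(\<Sum>i<n. \<bar>h (v i) - h (u i)\<bar>) < \<epsilon>"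
    if H: "(\<forall>i<n. a' \<le> u i \<and> u i \<le> v i \<and> v i \<le> b') \<and>
        disjoint_family_on (\<lambda>i. {u i<..<v i}) {..<n} \<and> (\<Sum>i<n. v i - u i) < min \<eta>1 \<eta>2"
    for n :: nat and u v
  proof -
    have "\<forall>i<n. a \<le> u i \<and> u i \<le> v i \<and> v i \<le> b"
      using H \<open>a \<le> a'\<close> \<open>b' \<le> b\<close> by force
    then have 1: "(\<Sum>i<n. \<bar>f (v i) - f (u i)\<bar>) < \<epsilon>'" "(\<Sum>i<n. \<bar>g (v i) - g (u i)\<bar>) < \<epsilon>'"
      using H by (auto intro!: \<eta>1[rule_format] \<eta>2[rule_format])
    have "(\<Sum>i<n. \<bar>h (v i) - h (u i)\<bar>) \<le> (\<Sum>i<n. M' * (\<bar>f (v i) - f (u i)\<bar> + \<bar>g (v i) - g (u i)\<bar>))"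
    proof (rule sum_mono)
      fix i assume "i \<in> {..<n}"
      then have "\<bar>h (v i) - h (u i)\<bar> \<le> M * (\<bar>f (v i) - f (u i)\<bar> + \<bar>g (v i) - g (u i)\<bar>)"
        using H by (intro dom) auto
      also have "\<dots> \<le> M' * (\<bar>f (v i) - f (u i)\<bar> + \<bar>g (v i) - g (u i)\<bar>)"
        by (intro mult_right_mono) (auto simp: M'_def)
      finally show "\<bar>h (v i) - h (u i)\<bar> \<le> M' * (\<bar>f (v i) - f (u i)\<bar> + \<bar>g (v i) - g (u i)\<bar>)" .
    qed
    also have "\<dots> = M' * ((\<Sum>i<n. \<bar>f (v i) - f (u i)\<bar>) + (\<Sum>i<n. \<bar>g (v i) - g (u i)\<bar>))"
      by (simp only: sum_distrib_left[symmetric] sum.distrib)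
    also have "\<dots> < M' * (\<epsilon>' + \<epsilon>')"
      using 1 \<open>M' > 0\<close> by (intro mult_strict_left_mono add_strict_mono)
    also have "\<dots> = \<epsilon>"
      using \<open>M' > 0\<close> by (simp add: \<epsilon>'_def)
    finally show ?thesis .
  qed
  then show "\<exists>\<eta>>0. \<forall>(n::nat) u v. (\<forall>i<n. a' \<le> u i \<and> u i \<le> v i \<and> v i \<le> b') \<and>
        disjoint_family_on (\<lambda>i. {u i<..<v i}) {..<n} \<and> (\<Sum>i<n. v i - u i) < \<eta>
        \<longrightarrow> (\<Sum>i<n. \<bar>h (v i) - h (u i)\<bar>) < \<epsilon>"
    using \<open>\<eta>1 > 0\<close> \<open>\<eta>2 > 0\<close> by (intro exI[of _ "min \<eta>1 \<eta>2"] conjI allI impI) auto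
qed

lemma abs_cont_on_subset: "abs_cont_on a b f \<Longrightarrow> a \<le> a' \<Longrightarrow> b' \<le> b \<Longrightarrow> abs_cont_on a' b' f"
  by (rule abs_cont_on_dominated[where M = 1 and f = f and g = f]) auto

lemma abs_cont_on_ident: "abs_cont_on a b (\<lambda>x. x)"
  unfolding abs_cont_on_def
proof (intro allI impI)
  fix \<epsilon> :: real assume "\<epsilon> > 0"
  show "\<exists>\<eta>>0. \<forall>(n::nat) u v. (\<forall>i<n. a \<le> u i \<and> u i \<le> v i \<and> v i \<le> b) \<and>
        disjoint_family_on (\<lambda>i. {u i<..<v i}) {..<n} \<and> (\<Sum>i<n. v i - u i) < \<eta>
        \<longrightarrow> (\<Sum>i<n. \<bar>v i - u i\<bar>) < \<epsilon>"
  proof (intro exI[of _ \<epsilon>] conjI allI impI \<open>\<epsilon> > 0\<close>, elim conjE)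
    fix n :: nat and u v :: "nat \<Rightarrow> real"
    assume "\<forall>i<n. a \<le> u i \<and> u i \<le> v i \<and> v i \<le> b" and less: "(\<Sum>i<n. v i - u i) < \<epsilon>"
    then have "(\<Sum>i<n. \<bar>v i - u i\<bar>) = (\<Sum>i<n. v i - u i)"
      by (intro sum.cong) auto
    then show "(\<Sum>i<n. \<bar>v i - u i\<bar>) < \<epsilon>" using less by simp
  qed
qed

lemma abs_cont_on_Lipschitz:
  assumes "\<And>u v. a \<le> u \<Longrightarrow> u \<le> v \<Longrightarrow> v \<le> b \<Longrightarrow> \<bar>f v - f u\<bar> \<le> M * \<bar>v - u\<bar>"
  shows "abs_cont_on a b f"
proof (rule abs_cont_on_dominated[OF abs_cont_on_ident abs_cont_on_ident order_refl order_refl])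
  show "\<bar>f v - f u\<bar> \<le> (M / 2) * (\<bar>v - u\<bar> + \<bar>v - u\<bar>)" if "a \<le> u" "u \<le> v" "v \<le> b" for u v
    using assms[OF that] by simp
qed

lemma abs_cont_on_diff:
  assumes "abs_cont_on a b f" "abs_cont_on a b g"
  shows "abs_cont_on a b (\<lambda>x. f x - g x)"
  by (rule abs_cont_on_dominated[OF assms order_refl order_refl, where M = 1]) auto

lemma abs_cont_on_cmult: "abs_cont_on a b f \<Longrightarrow> abs_cont_on a b (\<lambda>x. l * f x)"
  by (rule abs_cont_on_dominated[where M = "\<bar>l\<bar>" and f = f and g = f])
     (auto simp: abs_mult mult_left_mono right_diff_distrib[symmetric])

lemma abs_cont_on_imp_continuous_on:
  assumes "abs_cont_on a b f"
  shows "continuous_on {a..b} f"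
  unfolding continuous_on_iff
proof (intro ballI allI impI)
  fix x \<epsilon> :: real assume x: "x \<in> {a..b}" and "\<epsilon> > 0"
  obtain \<eta> where "\<eta> > 0" and \<eta>: "\<forall>(n::nat) u v. (\<forall>i<n. a \<le> u i \<and> u i \<le> v i \<and> v i \<le> b) \<and>
        disjoint_family_on (\<lambda>i. {u i<..<v i}) {..<n} \<and> (\<Sum>i<n. v i - u i) < \<eta>
        \<longrightarrow> (\<Sum>i<n. \<bar>f (v i) - f (u i)\<bar>) < \<epsilon>"
    using mp[OF spec[OF assms[unfolded abs_cont_on_def], of \<epsilon>] \<open>\<epsilon> > 0\<close>] by (elim exE conjE) (rule that)
  \<comment> \<open>A family of one interval suffices, with its end points put in order.\<close>
  have "\<bar>f y - f x\<bar> < \<epsilon>" if y: "y \<in> {a..b}" "\<bar>y - x\<bar> < \<eta>" for y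
    using \<eta>[rule_format, of 1 "\<lambda>_. min x y" "\<lambda>_. max x y"] x y
    by (cases "x \<le> y") (auto simp: disjoint_family_on_def min_def max_def abs_minus_commute)
  then show "\<exists>d>0. \<forall>x'\<in>{a..b}. dist x' x < d \<longrightarrow> dist (f x') (f x) < \<epsilon>"
    using \<open>\<eta> > 0\<close> by (auto simp: dist_real_def)
qed

lemma continuous_on_Icc_bounded:
  fixes f :: "real \<Rightarrow> real"
  assumes "continuous_on {a..b} f"
  obtains B where "\<And>x. x \<in> {a..b} \<Longrightarrow> \<bar>f x\<bar> \<le> B"
  using compact_imp_bounded[OF compact_continuous_image[OF assms compact_Icc]]
  unfolding bounded_iff by (auto simp del: atLeastAtMost_iff)

text \<open>Both factors are continuous, hence bounded on the compact interval, so the product rule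
  for increments gives domination.\<close>

lemma abs_cont_on_mult:
  assumes f: "abs_cont_on a b f" and g: "abs_cont_on a b g"
  shows "abs_cont_on a b (\<lambda>x. f x * g x)"
proof -
  obtain A where A: "\<And>x. x \<in> {a..b} \<Longrightarrow> \<bar>f x\<bar> \<le> A"
    using continuous_on_Icc_bounded[OF abs_cont_on_imp_continuous_on[OF f]] by blast
  obtain B where B: "\<And>x. x \<in> {a..b} \<Longrightarrow> \<bar>g x\<bar> \<le> B"
    using continuous_on_Icc_bounded[OF abs_cont_on_imp_continuous_on[OF g]] by blast
  show ?thesis
  proof (rule abs_cont_on_dominated[OF f g order_refl order_refl])
    fix u v assume uv: "a \<le> u" "u \<le> v" "v \<le> b"
    have "f v * g v - f u * g u = (f v - f u) * g v + f u * (g v - g u)"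
      by (simp add: algebra_simps)
    then have "\<bar>f v * g v - f u * g u\<bar> \<le> \<bar>f v - f u\<bar> * \<bar>g v\<bar> + \<bar>f u\<bar> * \<bar>g v - g u\<bar>"
      by (simp add: abs_mult[symmetric])
    also have "\<dots> \<le> \<bar>f v - f u\<bar> * max A B + max A B * \<bar>g v - g u\<bar>"
      using A[of u] B[of v] uv by (intro add_mono mult_mono) auto
    finally show "\<bar>f v * g v - f u * g u\<bar> \<le> max A B * (\<bar>f v - f u\<bar> + \<bar>g v - g u\<bar>)"
      by (simp add: algebra_simps)
  qed
qed

lemma abs_cont_on_C1:
  assumes der: "\<And>x. x \<in> {a..b} \<Longrightarrow> (f has_vector_derivative f' x) (at x within {a..b})"
    and cont: "continuous_on {a..b} f'"
  shows "abs_cont_on a b f"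
proof -
  obtain B where B: "\<And>x. x \<in> {a..b} \<Longrightarrow> \<bar>f' x\<bar> \<le> B"
    using continuous_on_Icc_bounded[OF cont] by blast
  show ?thesis
  proof (rule abs_cont_on_Lipschitz)
    fix u v assume uv: "a \<le> u" "u \<le> v" "v \<le> b"
    have "norm (f v - f u) \<le> B * norm (v - u)"
    proof (rule differentiable_bound)
      show "convex {a..b}" by simp
      show "(f has_derivative (\<lambda>h. h *\<^sub>R f' x)) (at x within {a..b})" if "x \<in> {a..b}" for x
        using der[OF that] by (simp add: has_vector_derivative_def)
      show "onorm (\<lambda>h. h *\<^sub>R f' x) \<le> B" if "x \<in> {a..b}" for x
        using mult_left_mono[OF B[OF that] abs_ge_zero]
        by (intro onorm_le) (simp add: abs_mult mult.commute)
    qed (use uv in auto)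
    then show "\<bar>f v - f u\<bar> \<le> B * \<bar>v - u\<bar>" by simp
  qed
qed

section \<open>Derivatives on the interval and square integrable functions\<close>

lemma derivI_0: "derivI 0 f = f"
  by (simp add: derivI_def)

lemma derivI_Suc: "derivI (Suc j) f x = vector_derivative (derivI j f) (at x within {-1..1})"
  by (simp add: derivI_def)

lemma derivI_Suc_eqI:
  assumes "x \<in> {-1..1}" "(derivI j f has_vector_derivative y) (at x within {-1..1})"
  shows "derivI (Suc j) f x = y"
  using vector_derivative_within_cbox[of "-1" 1 x "derivI j f" y] assms by (simp add: derivI_Suc)

lemma derivI_Suc_has_vector_derivative:
  assumes "derivI j f differentiable (at x within {-1..1})"
  shows "(derivI j f has_vector_derivative derivI (Suc j) f x) (at x within {-1..1})"
  using assms by (simp add: derivI_Suc vector_derivative_works)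

lemma L2rD_differentiable:
  assumes "f \<in> L2r r" "j < r - 1" "x \<in> {-1..1}"
  shows "(derivI j f has_vector_derivative derivI (Suc j) f x) (at x within {-1..1})"
  using assms by (intro derivI_Suc_has_vector_derivative) (auto simp: L2r_def differentiable_on_def)

lemma L2rD_AE_differentiable:
  assumes "f \<in> L2r r" "r \<ge> 1"
  shows "AE x in lebI. (derivI (r - 1) f has_vector_derivative derivI r f x) (at x within {-1..1})"
proof -
  have "AE x in lebI. derivI (r - 1) f differentiable (at x within {-1..1})"
    using assms by (simp add: L2r_def)
  then show ?thesis
    by eventually_elim (use derivI_Suc_has_vector_derivative[of "r - 1" f] assms(2) in simp)
qed

lemma L2r_continuous_on:
  assumes "f \<in> L2r r" "k < r"
  shows "continuous_on {-1..1} (derivI k f)"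
proof (cases "k < r - 1")
  case True
  then show ?thesis
    using assms by (intro differentiable_imp_continuous_on) (auto simp: L2r_def)
next
  case False
  then have "k = r - 1" using assms by simp
  then show ?thesis
    using assms by (intro abs_cont_on_imp_continuous_on) (auto simp: L2r_def)
qed

section \<open>Measurability and square integrability on the interval\<close>

lemma measurable_lebI_continuous_on:
  assumes "continuous_on {-1..1} f"
  shows "(f::real \<Rightarrow> real) \<in> borel_measurable lebI"
  using assms by (intro continuous_imp_measurable_on_sets_lebesgue) auto

text \<open>Completeness of Lebesgue measure, applied to the extensions by zero. It serves for
  derivatives of order \<open>r\<close>, which are known only almost everywhere.\<close>

lemma measurable_lebI_AE_eq:
  fixes f g :: "real \<Rightarrow> real"
  assumes f: "f \<in> borel_measurable lebI" and eq: "AE x in lebI. g x = f x"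
  shows "g \<in> borel_measurable lebI"
proof -
  have "(\<lambda>x. if x \<in> {-1..1} then f x else 0) \<in> borel_measurable lebesgue"
    using f by (subst borel_measurable_if) auto
  moreover have "AE x in lebesgue. (if x \<in> {-1..1} then f x else 0) = (if x \<in> {-1..1} then g x else 0)"
    using eq by (subst (asm) AE_restrict_space_iff) (auto elim!: eventually_mono)
  ultimately have "(\<lambda>x. if x \<in> {-1..1} then g x else 0) \<in> borel_measurable lebesgue"
    by (rule borel_measurable_AE)
  then show ?thesis by (subst (asm) borel_measurable_if) auto
qed

lemma L2_AE_eqI:
  assumes "g \<in> L2" "AE x in lebI. f x = g x"
  shows "f \<in> L2"
proof -
  have f: "f \<in> borel_measurable lebI"
    using assms(1) by (intro measurable_lebI_AE_eq[OF _ assms(2)]) (simp add: L2_def)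
  have "integrable lebI (\<lambda>x. (f x)\<^sup>2) \<longleftrightarrow> integrable lebI (\<lambda>x. (g x)\<^sup>2)"
  proof (rule integrable_cong_AE)
    show "AE x in lebI. (f x)\<^sup>2 = (g x)\<^sup>2"
      using assms(2) by eventually_elim simp
  qed (use assms f in \<open>auto simp: L2_def\<close>)
  then show ?thesis using assms f by (simp add: L2_def)
qed

lemma finite_measure_lebI: "finite_measure lebI"
  by (rule finite_measureI) (simp add: emeasure_restrict_space)

lemma L2_bounded:
  assumes "f \<in> borel_measurable lebI" "AE x in lebI. \<bar>f x\<bar> \<le> B"
  shows "f \<in> L2"
proof -
  have [measurable]: "f \<in> borel_measurable lebI" by fact
  have "integrable lebI (\<lambda>x. (f x)\<^sup>2)"
  proof (rule finite_measure.integrable_const_bound[OF finite_measure_lebI])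
    show "AE x in lebI. norm ((f x)\<^sup>2) \<le> B\<^sup>2"
      using assms(2) by eventually_elim (simp add: abs_le_square_iff[symmetric])
  qed measurable
  then show ?thesis using assms by (simp add: L2_def)
qed

lemma L2_continuous_on:
  assumes "continuous_on {-1..1} f"
  shows "f \<in> L2"
proof -
  obtain B where B: "\<And>x. x \<in> {-1..1} \<Longrightarrow> \<bar>f x\<bar> \<le> B"
    using continuous_on_Icc_bounded[OF assms] by blast
  show ?thesis
    by (rule L2_bounded[OF measurable_lebI_continuous_on[OF assms], of B])
       (auto intro!: AE_I2 B simp: space_restrict_space)
qed

lemma L2_integrable_mult:
  assumes "f \<in> L2" "g \<in> L2"
  shows "integrable lebI (\<lambda>x. f x * g x)"
proof (rule Bochner_Integration.integrable_bound)
  show "integrable lebI (\<lambda>x. (f x)\<^sup>2 + (g x)\<^sup>2)"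
    using assms by (auto simp: L2_def)
  show "(\<lambda>x. f x * g x) \<in> borel_measurable lebI"
    using assms by (auto simp: L2_def)
  have "\<bar>x * y\<bar> \<le> x\<^sup>2 + y\<^sup>2" for x y :: real
  proof -
    have "2 * (\<bar>x\<bar> * \<bar>y\<bar>) \<le> x\<^sup>2 + y\<^sup>2" "0 \<le> \<bar>x\<bar> * \<bar>y\<bar>"
      using sum_squares_bound[of "\<bar>x\<bar>" "\<bar>y\<bar>"] by (simp_all add: mult.assoc)
    then show ?thesis unfolding abs_mult by linarith
  qed
  then show "AE x in lebI. norm (f x * g x) \<le> norm ((f x)\<^sup>2 + (g x)\<^sup>2)"
    by (auto intro!: AE_I2)
qed

lemma L2_lincomb:
  assumes "f \<in> L2" "g \<in> L2"
  shows "(\<lambda>x. a * f x + b * g x) \<in> L2"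
proof -
  have "integrable lebI (\<lambda>x. a\<^sup>2 * (f x)\<^sup>2 + b\<^sup>2 * (g x)\<^sup>2 + 2 * a * b * (f x * g x))"
    using assms L2_integrable_mult[OF assms] by (auto simp: L2_def)
  moreover have "(\<lambda>x. a\<^sup>2 * (f x)\<^sup>2 + b\<^sup>2 * (g x)\<^sup>2 + 2 * a * b * (f x * g x)) = (\<lambda>x. (a * f x + b * g x)\<^sup>2)"
    by (auto simp: fun_eq_iff power2_eq_square algebra_simps)
  ultimately show ?thesis using assms by (auto simp: L2_def)
qed

lemma norm2_power2: "(norm2 f)\<^sup>2 = (\<integral>x. (f x)\<^sup>2 \<partial>lebI)"
  by (simp add: norm2_def)

lemma norm2_nonneg: "norm2 f \<ge> 0"
  by (simp add: norm2_def)

text \<open>Cauchy-Schwarz for the semi-inner product on pairs \<open>(f, f')\<close> with weight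
  \<open>l\<close> on the second component. The primed functions are arbitrary, not derivatives;
  this freedom is used when the error of the method is estimated.\<close>

lemma L2_Cauchy_Schwarz_pair:
  assumes "f \<in> L2" "g \<in> L2" "f' \<in> L2" "g' \<in> L2" and "l \<ge> 0"
  shows "((\<integral>x. f x * g x \<partial>lebI) + l * (\<integral>x. f' x * g' x \<partial>lebI))\<^sup>2
      \<le> ((\<integral>x. (f x)\<^sup>2 \<partial>lebI) + l * (\<integral>x. (f' x)\<^sup>2 \<partial>lebI)) * ((\<integral>x. (g x)\<^sup>2 \<partial>lebI) + l * (\<integral>x. (g' x)\<^sup>2 \<partial>lebI))"
proof -
  define P where "P = (\<integral>x. (f x)\<^sup>2 \<partial>lebI) + l * (\<integral>x. (f' x)\<^sup>2 \<partial>lebI)"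
  define Q where "Q = (\<integral>x. f x * g x \<partial>lebI) + l * (\<integral>x. f' x * g' x \<partial>lebI)"
  define R where "R = (\<integral>x. (g x)\<^sup>2 \<partial>lebI) + l * (\<integral>x. (g' x)\<^sup>2 \<partial>lebI)"
  have expand: "(\<integral>x. (a * f x + b * g x)\<^sup>2 \<partial>lebI)
      = a\<^sup>2 * (\<integral>x. (f x)\<^sup>2 \<partial>lebI) + b\<^sup>2 * (\<integral>x. (g x)\<^sup>2 \<partial>lebI) + 2 * a * b * (\<integral>x. f x * g x \<partial>lebI)"
    if "f \<in> L2" "g \<in> L2" for f g a b
  proof -
    have "(\<integral>x. (a * f x + b * g x)\<^sup>2 \<partial>lebI) = (\<integral>x. a\<^sup>2 * (f x)\<^sup>2 + b\<^sup>2 * (g x)\<^sup>2 + 2 * a * b * (f x * g x) \<partial>lebI)"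
      by (rule Bochner_Integration.integral_cong) (auto simp: power2_eq_square algebra_simps)
    also have "\<dots> = a\<^sup>2 * (\<integral>x. (f x)\<^sup>2 \<partial>lebI) + b\<^sup>2 * (\<integral>x. (g x)\<^sup>2 \<partial>lebI) + 2 * a * b * (\<integral>x. f x * g x \<partial>lebI)"
      using that L2_integrable_mult[OF that] by (simp add: L2_def)
    finally show ?thesis .
  qed
  \<comment> \<open>The quadratic form of the combination with coefficients \<open>a\<close> and
    \<open>b\<close>; suitable values of these give the inequality.\<close>
  have q: "0 \<le> a\<^sup>2 * P + b\<^sup>2 * R + 2 * a * b * Q" for a b
  proof -
    have "0 \<le> (\<integral>x. (a * f x + b * g x)\<^sup>2 \<partial>lebI) + l * (\<integral>x. (a * f' x + b * g' x)\<^sup>2 \<partial>lebI)"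
      using \<open>l \<ge> 0\<close> by simp
    also have "\<dots> = a\<^sup>2 * P + b\<^sup>2 * R + 2 * a * b * Q"
      unfolding expand[OF assms(1,2)] expand[OF assms(3,4)] P_def Q_def R_def by (simp add: algebra_simps)
    finally show ?thesis .
  qed
  have "R \<ge> 0" using \<open>l \<ge> 0\<close> by (simp add: R_def)
  have "Q\<^sup>2 \<le> P * R"
  proof (cases "R = 0")
    case True
    have "Q = 0"
    proof (rule ccontr)
      assume "Q \<noteq> 0"
      \<comment> \<open>For \<open>R = 0\<close> the form with \<open>a = 1\<close> is affine in
        \<open>b\<close>; this \<open>b\<close> would give it the value -1.\<close>
      have "0 \<le> P + 2 * (- (P + 1) / (2 * Q)) * Q"
        using q[of 1 "- (P + 1) / (2 * Q)"] True by simp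
      also have "\<dots> = - 1" using \<open>Q \<noteq> 0\<close> by (simp add: field_simps)
      finally show False by simp
    qed
    then show ?thesis using True by simp
  next
    case False
    then have "R > 0" using \<open>R \<ge> 0\<close> by simp
    \<comment> \<open>The values \<open>a = R\<close> and \<open>b = - Q\<close> minimize the form
      up to scaling.\<close>
    have "0 \<le> R * (P * R - Q\<^sup>2)"
      using q[of R "- Q"] by (simp add: power2_eq_square algebra_simps)
    then show ?thesis using \<open>R > 0\<close> by (simp add: zero_le_mult_iff)
  qed
  then show ?thesis by (simp add: P_def Q_def R_def)
qed

section \<open>Scaling in the Sobolev class\<close>

text \<open>Below order \<open>r\<close> each derivative arises from a function differentiable at
  every point, so no exceptional set appears.\<close>

lemma derivI_cmult:
  assumes "f \<in> L2r r" "j < r" "x \<in> {-1..1}"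
  shows "derivI j (\<lambda>x. a * f x) x = a * derivI j f x"
  using assms(2,3)
proof (induction j arbitrary: x)
  case 0
  then show ?case by (simp add: derivI_0)
next
  case (Suc j)
  show ?case
  proof (rule derivI_Suc_eqI[OF Suc.prems(2)])
    have "((\<lambda>x. a * derivI j f x) has_vector_derivative a * derivI (Suc j) f x) (at x within {-1..1})"
      using L2rD_differentiable[OF assms(1), of j x] Suc.prems
      by (intro has_vector_derivative_mult_right) auto
    then show "(derivI j (\<lambda>x. a * f x) has_vector_derivative a * derivI (Suc j) f x) (at x within {-1..1})"
      by (rule has_vector_derivative_transform[rotated 2]) (use Suc in auto)
  qed
qed

text \<open>Needed to normalize the extremal function and to pass from \<open>f\<close> to its
  negative. At order \<open>r\<close> the identity holds only almost everywhere, since the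
  derivative may fail to exist on a null set.\<close>

lemma L2r_cmult:
  assumes f: "f \<in> L2r r" and "r \<ge> 1"
  shows "(\<lambda>x. a * f x) \<in> L2r r"
    and "AE x in lebI. derivI r (\<lambda>x. a * f x) x = a * derivI r f x"
proof -
  have hvd: "(derivI j (\<lambda>x. a * f x) has_vector_derivative a * y) (at x within {-1..1})"
    if "(derivI j f has_vector_derivative y) (at x within {-1..1})" "j < r" "x \<in> {-1..1}" for j x y
  proof (rule has_vector_derivative_transform[OF that(3)])
    show "((\<lambda>x. a * derivI j f x) has_vector_derivative a * y) (at x within {-1..1})"
      using that(1) by (rule has_vector_derivative_mult_right)
    show "\<And>x. x \<in> {-1..1} \<Longrightarrow> derivI j (\<lambda>x. a * f x) x = a * derivI j f x"
      using derivI_cmult[OF f that(2)] by simp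
  qed
  have sp: "AE x in lebI. x \<in> {-1..1}" by (auto intro!: AE_I2 simp: space_restrict_space)
  have AE: "AE x in lebI. (derivI (r - 1) (\<lambda>x. a * f x) has_vector_derivative a * derivI r f x) (at x within {-1..1})"
    using L2rD_AE_differentiable[OF assms] sp
    by eventually_elim (use hvd[of "r - 1"] \<open>r \<ge> 1\<close> in auto)
  then show eq: "AE x in lebI. derivI r (\<lambda>x. a * f x) x = a * derivI r f x"
    using sp by eventually_elim (use derivI_Suc_eqI[of _ "r - 1" "\<lambda>x. a * f x"] \<open>r \<ge> 1\<close> in auto)
  have d: "derivI r f \<in> L2" using f by (simp add: L2r_def)
  have "(\<lambda>x. a * derivI r f x) \<in> L2" using L2_lincomb[OF d d, of a 0] by simp
  then have "derivI r (\<lambda>x. a * f x) \<in> L2"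
    using eq by (rule L2_AE_eqI)
  moreover have "abs_cont_on (-1) 1 (derivI (r - 1) (\<lambda>x. a * f x))"
  proof (rule abs_cont_on_dominated[where M = "\<bar>a\<bar>"])
    show "abs_cont_on (-1) 1 (derivI (r - 1) f)" "abs_cont_on (-1) 1 (derivI (r - 1) f)"
      using f by (auto simp: L2r_def)
    fix u v :: real assume "-1 \<le> u" "u \<le> v" "v \<le> 1"
    then have "derivI (r - 1) (\<lambda>x. a * f x) v - derivI (r - 1) (\<lambda>x. a * f x) u = a * (derivI (r - 1) f v - derivI (r - 1) f u)"
      using derivI_cmult[OF f, of "r - 1" u a] derivI_cmult[OF f, of "r - 1" v a] \<open>r \<ge> 1\<close> by (simp add: algebra_simps)
    then show "\<bar>derivI (r - 1) (\<lambda>x. a * f x) v - derivI (r - 1) (\<lambda>x. a * f x) u\<bar>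
        \<le> \<bar>a\<bar> * (\<bar>derivI (r - 1) f v - derivI (r - 1) f u\<bar> + \<bar>derivI (r - 1) f v - derivI (r - 1) f u\<bar>)"
      by (simp add: abs_mult mult_left_mono)
  qed auto
  moreover have "derivI j (\<lambda>x. a * f x) differentiable_on {-1..1}" if "j < r - 1" for j
    unfolding differentiable_on_def
  proof
    fix x :: real assume x: "x \<in> {-1..1}"
    show "derivI j (\<lambda>x. a * f x) differentiable (at x within {-1..1})"
      using hvd[OF L2rD_differentiable[OF f that x] _ x] that differentiableI_vector by fastforce
  qed
  moreover have "AE x in lebI. derivI (r - 1) (\<lambda>x. a * f x) differentiable (at x within {-1..1})"
    using AE by eventually_elim (auto intro: differentiableI_vector)
  ultimately show "(\<lambda>x. a * f x) \<in> L2r r"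
    by (auto simp: L2r_def)
qed

section \<open>Families of representers\<close>

text \<open>Outside a compact interval around 1 the values exceed \<open>F 1\<close>, so a minimum
  over that interval is a global one.\<close>

lemma attains_min_of_filterlim_at_top:
  fixes F :: "real \<Rightarrow> real"
  assumes cont: "continuous_on {0<..} F"
    and lim0: "filterlim F at_top (at_right 0)" and lim_top: "filterlim F at_top at_top"
  obtains c where "c > 0" "\<And>x. x > 0 \<Longrightarrow> F c \<le> F x"
proof -
  have "eventually (\<lambda>x. F x > F 1) (at_right 0)"
    using lim0 by (simp add: filterlim_at_top_dense)
  then obtain \<alpha> where \<alpha>: "\<alpha> > 0" "\<And>x. x > 0 \<Longrightarrow> x < \<alpha> \<Longrightarrow> F x > F 1"
    by (auto simp: eventually_at_right_field)
  have "eventually (\<lambda>x. F x > F 1) at_top"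
    using lim_top by (simp add: filterlim_at_top_dense)
  then obtain \<beta> where \<beta>: "\<And>x. x \<ge> \<beta> \<Longrightarrow> F x > F 1"
    by (auto simp: eventually_at_top_linorder)
  define S where "S = {min \<alpha> 1..max \<beta> 1}"
  have "\<exists>c\<in>S. \<forall>x\<in>S. F c \<le> F x"
    using \<alpha>(1) unfolding S_def
    by (intro continuous_attains_inf continuous_on_subset[OF cont]) auto
  then obtain c where c: "c \<in> S" "\<And>x. x \<in> S \<Longrightarrow> F c \<le> F x" by blast
  have "F c \<le> F 1" using c(2)[of 1] by (simp add: S_def)
  have "c > 0" using c(1) \<alpha>(1) by (auto simp: S_def)
  moreover have "F c \<le> F x" if "x > 0" for x
  proof (cases "x \<in> S")
    case False
    then have "x < \<alpha> \<or> x \<ge> \<beta>" using that by (auto simp: S_def)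
    then have "F 1 < F x" using \<alpha> \<beta> that by auto
    then show ?thesis using \<open>F c \<le> F 1\<close> by simp
  qed (use c in auto)
  ultimately show thesis by (rule that)
qed

text \<open>
  Both products are minimal at \<open>c\<^sub>0\<close>, so their derivatives vanish there, and
  eliminating \<open>\<phi>'(c\<^sub>0)\<close> leaves \<open>\<mu>'(c\<^sub>0) (a - D b) = 0\<close>.
\<close>

lemma envelope_balance:
  fixes \<phi> \<mu> :: "real \<Rightarrow> real"
  assumes "c\<^sub>0 > 0" and \<phi>: "(\<phi> has_real_derivative \<phi>') (at c\<^sub>0)" and \<mu>: "(\<mu> has_real_derivative \<mu>') (at c\<^sub>0)"
    and "\<mu>' \<noteq> 0" and val: "\<phi> c\<^sub>0 = a + \<mu> c\<^sub>0 * b" and pos: "\<phi> c\<^sub>0 > 0"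
    and min: "\<And>c. c > 0 \<Longrightarrow> \<phi> c\<^sub>0 * (D + \<mu> c\<^sub>0) \<le> \<phi> c * (D + \<mu> c)"
    and bound: "\<And>c. c > 0 \<Longrightarrow> (\<phi> c\<^sub>0)\<^sup>2 \<le> (a + \<mu> c * b) * \<phi> c"
  shows "a = D * b"
proof -
  have near: "c > 0" if "\<bar>c\<^sub>0 - c\<bar> < c\<^sub>0" for c using that by linarith
  have "((\<lambda>c. \<phi> c * (D + \<mu> c)) has_real_derivative \<phi>' * (D + \<mu> c\<^sub>0) + \<mu>' * \<phi> c\<^sub>0) (at c\<^sub>0)"
    by (auto intro!: derivative_eq_intros \<phi> \<mu>)
  then have F: "\<phi>' * (D + \<mu> c\<^sub>0) + \<mu>' * \<phi> c\<^sub>0 = 0"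
    by (rule DERIV_local_min[OF _ \<open>c\<^sub>0 > 0\<close>]) (use near min in blast)
  have "((\<lambda>c. (a + \<mu> c * b) * \<phi> c) has_real_derivative \<mu>' * b * \<phi> c\<^sub>0 + \<phi>' * (a + \<mu> c\<^sub>0 * b)) (at c\<^sub>0)"
    by (auto intro!: derivative_eq_intros \<phi> \<mu>)
  then have "\<mu>' * b * \<phi> c\<^sub>0 + \<phi>' * (a + \<mu> c\<^sub>0 * b) = 0"
  proof (rule DERIV_local_min[OF _ \<open>c\<^sub>0 > 0\<close>], intro allI impI)
    fix c assume "\<bar>c\<^sub>0 - c\<bar> < c\<^sub>0"
    then show "(a + \<mu> c\<^sub>0 * b) * \<phi> c\<^sub>0 \<le> (a + \<mu> c * b) * \<phi> c"
      using bound[OF near, of c] val by (simp add: power2_eq_square)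
  qed
  then have "\<phi> c\<^sub>0 * (\<mu>' * b + \<phi>') = 0"
    using val by (simp add: algebra_simps)
  then have "\<phi>' = - \<mu>' * b" using pos by auto
  then have "\<mu>' * (a - D * b) = 0"
    using F val by (simp add: algebra_simps)
  then show ?thesis using \<open>\<mu>' \<noteq> 0\<close> by simp
qed

section \<open>Optimal recovery for an abstract family of representers\<close>

lemma AE_lebI_I: "(\<And>x. x \<in> {-1..1} \<Longrightarrow> P x) \<Longrightarrow> AE x in lebI. P x"
  by (auto intro!: AE_I2 simp: space_restrict_space)

lemma norm_inf_le:
  assumes "f \<in> borel_measurable lebI" "AE x in lebI. \<bar>f x\<bar> \<le> B"
  shows "norm_inf f \<le> ennreal B"
  unfolding norm_inf_def
proof (rule esssup_I)
  show "(\<lambda>x. ennreal \<bar>f x\<bar>) \<in> borel_measurable lebI" using assms(1) by measurable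
  show "AE x in lebI. ennreal \<bar>f x\<bar> \<le> ennreal B"
    using assms(2) by eventually_elim (rule ennreal_leI)
qed

text \<open>Collects what the recovery argument uses, so that it is carried out once for all three
  kernels. Here \<open>\<mu> c\<close> is the weight \<lambda> of the inner product and
  \<open>\<phi> c\<close> the diagonal value at -1. For \<delta> > 0, \<open>lim_0\<close> and
  \<open>\<phi>_lim_top\<close> give a minimizer of the error bound; \<open>lim_top\<close> serves
  the case \<delta> = 0.\<close>

locale representer_family =
  fixes r k :: nat and \<mu> \<phi> :: "real \<Rightarrow> real" and w :: "real \<Rightarrow> real \<Rightarrow> real \<Rightarrow> real"
  assumes k_less: "k < r"
    and \<mu>_pos: "c > 0 \<Longrightarrow> \<mu> c > 0"
    and \<phi>_pos: "c > 0 \<Longrightarrow> \<phi> c > 0"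
    and w_L2r: "c > 0 \<Longrightarrow> t \<in> {-1..1} \<Longrightarrow> w c t \<in> L2r r"
    and represents: "c > 0 \<Longrightarrow> t \<in> {-1..1} \<Longrightarrow> f \<in> L2r r \<Longrightarrow>
      derivI k f t = (\<integral>x. f x * w c t x \<partial>lebI) + \<mu> c * (\<integral>x. derivI r f x * derivI r (w c t) x \<partial>lebI)"
    and diag_le: "c > 0 \<Longrightarrow> t \<in> {-1..1} \<Longrightarrow> derivI k (w c t) t \<le> \<phi> c"
    and diag_left: "c > 0 \<Longrightarrow> derivI k (w c (-1)) (-1) = \<phi> c"
    and w_continuous: "c > 0 \<Longrightarrow> continuous_on UNIV (\<lambda>(t, x). w c t x)"
    and \<phi>_differentiable: "c > 0 \<Longrightarrow> \<exists>d. (\<phi> has_real_derivative d) (at c)"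
    and \<mu>_derivative: "c > 0 \<Longrightarrow> \<exists>d. d \<noteq> 0 \<and> (\<mu> has_real_derivative d) (at c)"
    and lim_0: "filterlim (\<lambda>c. \<phi> c * \<mu> c) at_top (at_right 0)"
    and \<phi>_lim_top: "filterlim \<phi> at_top at_top"
    and lim_top: "((\<lambda>c. \<phi> c * \<mu> c) \<longlongrightarrow> 0) at_top"
begin

lemma L2r_L2: "f \<in> L2r r \<Longrightarrow> f \<in> L2"
  using L2r_continuous_on[of f r 0] k_less by (intro L2_continuous_on) (simp add: derivI_0)

lemma derivI_r_L2: "f \<in> L2r r \<Longrightarrow> derivI r f \<in> L2"
  by (simp add: L2r_def)

text \<open>The reproducing property applied to the representer itself.\<close>

lemma energy_w:
  assumes "c > 0" "t \<in> {-1..1}"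
  shows "(\<integral>x. (w c t x)\<^sup>2 \<partial>lebI) + \<mu> c * (\<integral>x. (derivI r (w c t) x)\<^sup>2 \<partial>lebI) = derivI k (w c t) t"
  using represents[OF assms w_L2r[OF assms]] by (simp add: power2_eq_square)

text \<open>Cauchy-Schwarz, with the energy of the representer replaced by its diagonal value and
  then by \<open>\<phi> c\<close>. The pair \<open>h\<close>, \<open>h'\<close> is not tied by
  differentiation: in the error estimate \<open>h\<close> is \<open>f - g\<close>, while
  \<open>h'\<close> is the derivative of \<open>f\<close> alone.\<close>

lemma pairing_bound:
  assumes c: "c > 0" and t: "t \<in> {-1..1}" and "h \<in> L2" "h' \<in> L2"
  shows "((\<integral>x. h x * w c t x \<partial>lebI) + \<mu> c * (\<integral>x. h' x * derivI r (w c t) x \<partial>lebI))\<^sup>2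
      \<le> ((\<integral>x. (h x)\<^sup>2 \<partial>lebI) + \<mu> c * (\<integral>x. (h' x)\<^sup>2 \<partial>lebI)) * \<phi> c"
proof -
  have w: "w c t \<in> L2" "derivI r (w c t) \<in> L2"
    using w_L2r[OF c t] by (auto intro: L2r_L2 derivI_r_L2)
  have "((\<integral>x. h x * w c t x \<partial>lebI) + \<mu> c * (\<integral>x. h' x * derivI r (w c t) x \<partial>lebI))\<^sup>2
      \<le> ((\<integral>x. (h x)\<^sup>2 \<partial>lebI) + \<mu> c * (\<integral>x. (h' x)\<^sup>2 \<partial>lebI)) * derivI k (w c t) t"
    unfolding energy_w[OF c t, symmetric]
    using \<mu>_pos[OF c] by (intro L2_Cauchy_Schwarz_pair assms w) simp
  also have "\<dots> \<le> ((\<integral>x. (h x)\<^sup>2 \<partial>lebI) + \<mu> c * (\<integral>x. (h' x)\<^sup>2 \<partial>lebI)) * \<phi> c"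
    using \<mu>_pos[OF c] by (intro mult_left_mono diag_le c t add_nonneg_nonneg mult_nonneg_nonneg) auto
  finally show ?thesis .
qed

definition S :: "real \<Rightarrow> (real \<Rightarrow> real) \<Rightarrow> real \<Rightarrow> real" where
  "S c g t = (\<integral>x. g x * w c t x \<partial>lebI)"

text \<open>Joint continuity of the kernel makes the integrand measurable on the product space;
  integrating out \<open>x\<close> then leaves a measurable function of \<open>t\<close>.\<close>

lemma measurable_S:
  assumes c: "c > 0" and g: "g \<in> L2"
  shows "S c g \<in> borel_measurable lebI"
proof -
  interpret finite_measure lebI by (rule finite_measure_lebI)
  have [measurable]: "g \<in> borel_measurable lebI" using g by (simp add: L2_def)
  have wm: "(\<lambda>p. w c (fst p) (snd p)) \<in> borel_measurable borel"
    using borel_measurable_continuous_onI[OF w_continuous[OF c]] by (simp add: case_prod_beta')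
  have id[measurable]: "(\<lambda>x. x) \<in> measurable lebI borel"
    by (rule measurable_lebI_continuous_on) (rule continuous_on_id)
  \<comment> \<open>The identity is measurable from the product of \<open>lebI\<close> with itself
    to the Borel plane, so the Borel measurable kernel can be composed with it.\<close>
  have "(\<lambda>p. (fst p, snd p)) \<in> measurable (lebI \<Otimes>\<^sub>M lebI) (borel :: (real \<times> real) measure)"
    unfolding borel_prod[symmetric]
    by (intro measurable_Pair measurable_compose[OF measurable_fst id] measurable_compose[OF measurable_snd id])
  from measurable_compose[OF this wm]
  have "(\<lambda>p. w c (fst p) (snd p)) \<in> borel_measurable (lebI \<Otimes>\<^sub>M lebI)" by simp
  then have "(\<lambda>(t, x). g x * w c t x) \<in> borel_measurable (lebI \<Otimes>\<^sub>M lebI)"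
    by (simp add: case_prod_beta')
  then show ?thesis
    unfolding S_def by (rule borel_measurable_lebesgue_integral)
qed

lemma S_linear:
  assumes c: "c > 0"
  shows "S c \<in> linear_maps"
proof -
  have "S c g \<in> Linf" if g: "g \<in> L2" for g
  proof -
    have "\<bar>S c g t\<bar> \<le> sqrt ((\<integral>x. (g x)\<^sup>2 \<partial>lebI) * \<phi> c)" if t: "t \<in> {-1..1}" for t
    proof (rule real_le_rsqrt)
      \<comment> \<open>With second component zero the pairing bound becomes a bound on
        \<open>S c g\<close> uniform in \<open>t\<close>.\<close>
      have "(\<lambda>x. 0) \<in> L2" by (simp add: L2_def)
      from pairing_bound[OF c t g this] show "\<bar>S c g t\<bar>\<^sup>2 \<le> (\<integral>x. (g x)\<^sup>2 \<partial>lebI) * \<phi> c"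
        by (simp add: S_def)
    qed
    then have "norm_inf (S c g) \<le> ennreal (sqrt ((\<integral>x. (g x)\<^sup>2 \<partial>lebI) * \<phi> c))"
      by (intro norm_inf_le measurable_S[OF c g] AE_lebI_I)
    also have "\<dots> < \<infinity>" by simp
    finally show ?thesis using measurable_S[OF c g] by (simp add: Linf_def)
  qed
  moreover have "AE t in lebI. S c g t = S c h t"
    if "g \<in> L2" "h \<in> L2" and eq: "AE x in lebI. g x = h x" for g h
  proof (rule AE_lebI_I)
    fix t :: real assume t: "t \<in> {-1..1}"
    have wt: "w c t \<in> borel_measurable lebI"
      using L2r_L2[OF w_L2r[OF c t]] by (simp add: L2_def)
    have gm: "g \<in> borel_measurable lebI" "h \<in> borel_measurable lebI"
      using that by (auto simp: L2_def)
    show "S c g t = S c h t"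
      unfolding S_def
    proof (rule integral_cong_AE)
      show "AE x in lebI. g x * w c t x = h x * w c t x"
        using eq by eventually_elim simp
    qed (intro borel_measurable_times gm wt)+
  qed
  moreover have "AE t in lebI. S c (\<lambda>y. a * g y + b * h y) t = a * S c g t + b * S c h t"
    if g: "g \<in> L2" and h: "h \<in> L2" for g h a b
  proof (rule AE_lebI_I)
    fix t :: real assume t: "t \<in> {-1..1}"
    have wt: "w c t \<in> L2" by (rule L2r_L2[OF w_L2r[OF c t]])
    have "S c (\<lambda>y. a * g y + b * h y) t = (\<integral>x. a * (g x * w c t x) + b * (h x * w c t x) \<partial>lebI)"
      unfolding S_def by (rule Bochner_Integration.integral_cong) (auto simp: algebra_simps)
    also have "\<dots> = a * S c g t + b * S c h t"
      unfolding S_def using L2_integrable_mult[OF g wt] L2_integrable_mult[OF h wt] by simp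
    finally show "S c (\<lambda>y. a * g y + b * h y) t = a * S c g t + b * S c h t" .
  qed
  ultimately show ?thesis
    unfolding linear_maps_def all_maps_def by (intro CollectI conjI ballI allI impI) auto
qed

lemma measurable_derivI_k: "f \<in> L2r r \<Longrightarrow> derivI k f \<in> borel_measurable lebI"
  using k_less by (intro measurable_lebI_continuous_on L2r_continuous_on)

lemma recovery_error_linear_le:
  assumes c: "c > 0" and "\<delta> \<ge> 0"
  shows "recovery_error linear_maps k r \<delta> \<le> ennreal (sqrt (\<phi> c * (\<delta>\<^sup>2 + \<mu> c)))"
  unfolding recovery_error_def
proof (rule INF_lower2[OF S_linear[OF c]], rule SUP_least, clarify)
  fix f g assume f: "f \<in> W2 r" and g: "g \<in> L2" and fg: "norm2 (\<lambda>x. f x - g x) \<le> \<delta>"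
  have fr: "f \<in> L2r r" and n: "norm2 (derivI r f) \<le> 1" using f by (auto simp: W2_def)
  have d: "(\<lambda>x. f x - g x) \<in> L2" using L2_lincomb[OF L2r_L2[OF fr] g, of 1 "-1"] by simp
  have "\<bar>derivI k f t - S c g t\<bar> \<le> sqrt (\<phi> c * (\<delta>\<^sup>2 + \<mu> c))" if t: "t \<in> {-1..1}" for t
  proof (rule real_le_rsqrt)
    have wt: "w c t \<in> L2" by (rule L2r_L2[OF w_L2r[OF c t]])
    have "(\<integral>x. f x * w c t x \<partial>lebI) - S c g t = (\<integral>x. (f x - g x) * w c t x \<partial>lebI)"
      unfolding S_def using L2_integrable_mult[OF L2r_L2[OF fr] wt] L2_integrable_mult[OF g wt]
      by (simp add: left_diff_distrib)
    then have "derivI k f t - S c g t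
        = (\<integral>x. (f x - g x) * w c t x \<partial>lebI) + \<mu> c * (\<integral>x. derivI r f x * derivI r (w c t) x \<partial>lebI)"
      using represents[OF c t fr] by simp
    then have "(derivI k f t - S c g t)\<^sup>2
        \<le> ((\<integral>x. (f x - g x)\<^sup>2 \<partial>lebI) + \<mu> c * (\<integral>x. (derivI r f x)\<^sup>2 \<partial>lebI)) * \<phi> c"
      using pairing_bound[OF c t d derivI_r_L2[OF fr]] by simp
    also have "\<dots> = ((norm2 (\<lambda>x. f x - g x))\<^sup>2 + \<mu> c * (norm2 (derivI r f))\<^sup>2) * \<phi> c"
      by (simp add: norm2_power2)
    also have "\<dots> \<le> (\<delta>\<^sup>2 + \<mu> c * 1\<^sup>2) * \<phi> c"
      using fg n \<mu>_pos[OF c] \<phi>_pos[OF c]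
      by (intro mult_right_mono add_mono power_mono mult_left_mono norm2_nonneg) auto
    finally show "\<bar>derivI k f t - S c g t\<bar>\<^sup>2 \<le> \<phi> c * (\<delta>\<^sup>2 + \<mu> c)" by (simp add: mult.commute)
  qed
  then show "norm_inf (\<lambda>x. derivI k f x - S c g x) \<le> ennreal (sqrt (\<phi> c * (\<delta>\<^sup>2 + \<mu> c)))"
    using measurable_derivI_k[OF fr] measurable_S[OF c g] by (intro norm_inf_le AE_lebI_I) auto
qed

lemma Omega_left_ge:
  assumes "\<delta> > 0"
  shows "\<exists>c>0. ennreal (sqrt (\<phi> c * (\<delta>\<^sup>2 + \<mu> c))) \<le> Omega_left k r \<delta>"
proof -
  define F where "F = (\<lambda>c. \<phi> c * (\<delta>\<^sup>2 + \<mu> c))"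
  have "continuous (at c within {0<..}) F" if c: "c > 0" for c
  proof -
    obtain d d' where d: "(\<phi> has_real_derivative d) (at c)" "(\<mu> has_real_derivative d') (at c)"
      using \<phi>_differentiable[OF c] \<mu>_derivative[OF c] by auto
    have "(F has_real_derivative d * (\<delta>\<^sup>2 + \<mu> c) + d' * \<phi> c) (at c)"
      unfolding F_def by (auto intro!: derivative_eq_intros d)
    then show ?thesis by (rule continuous_at_imp_continuous_at_within[OF DERIV_isCont])
  qed
  then have "continuous_on {0<..} F" by (simp add: continuous_on_eq_continuous_within)
  \<comment> \<open>Near 0 the product \<open>\<phi> c * \<mu> c\<close> blows up by itself; at
    infinity it is the term with \<open>\<delta>\<^sup>2\<close> that does, which requires \<delta>
    > 0.\<close>
  moreover have "filterlim F at_top (at_right 0)"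
  proof (rule filterlim_at_top_mono[OF lim_0])
    show "\<forall>\<^sub>F c in at_right 0. \<phi> c * \<mu> c \<le> F c"
      unfolding eventually_at_right_field F_def
      by (intro exI[of _ 1]) (auto simp: distrib_left less_imp_le[OF \<phi>_pos])
  qed
  moreover have "filterlim F at_top at_top"
  proof (rule filterlim_at_top_mono)
    show "filterlim (\<lambda>c. \<delta>\<^sup>2 * \<phi> c) at_top at_top"
      using \<open>\<delta> > 0\<close> by (intro filterlim_tendsto_pos_mult_at_top[OF tendsto_const _ \<phi>_lim_top]) simp
    show "\<forall>\<^sub>F c in at_top. \<delta>\<^sup>2 * \<phi> c \<le> F c"
      using eventually_gt_at_top[of 0]
      by eventually_elim (simp add: F_def distrib_left less_imp_le[OF \<phi>_pos] less_imp_le[OF \<mu>_pos])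
  qed
  ultimately obtain c where c: "c > 0" and min: "\<And>x. x > 0 \<Longrightarrow> F c \<le> F x"
    by (rule attains_min_of_filterlim_at_top) blast
  define f where "f = w c (-1)"
  have f: "f \<in> L2r r" using w_L2r[OF c, of "-1"] by (simp add: f_def)
  define a where "a = (\<integral>x. (f x)\<^sup>2 \<partial>lebI)"
  define b where "b = (\<integral>x. (derivI r f x)\<^sup>2 \<partial>lebI)"
  have val: "\<phi> c = a + \<mu> c * b"
    using energy_w[OF c, of "-1"] diag_left[OF c] by (simp add: a_def b_def f_def)
  have fk: "derivI k f (-1) = \<phi> c" using diag_left[OF c] by (simp add: f_def)
  \<comment> \<open>The representer for the fixed parameter \<open>c\<close> is tested against every
    parameter \<open>x\<close>. Equality holds at \<open>x = c\<close>, which supplies the second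
    minimum property for \<open>envelope_balance\<close>.\<close>
  have bound: "(\<phi> c)\<^sup>2 \<le> (a + \<mu> x * b) * \<phi> x" if "x > 0" for x
    using pairing_bound[OF that, of "-1", OF _ L2r_L2[OF f] derivI_r_L2[OF f]] represents[OF that, of "-1", OF _ f]
    by (simp add: fk a_def b_def)
  obtain d d' where d: "(\<phi> has_real_derivative d) (at c)" "(\<mu> has_real_derivative d') (at c)" "d' \<noteq> 0"
    using \<phi>_differentiable[OF c] \<mu>_derivative[OF c] by auto
  \<comment> \<open>The norm of \<open>f\<close> is \<delta> times that of its derivative of order
    \<open>r\<close>, so normalizing the latter to 1 gives a function of norm \<delta>.\<close>
  have ab: "a = \<delta>\<^sup>2 * b"
    by (rule envelope_balance[OF c d val \<phi>_pos[OF c] min[unfolded F_def] bound])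
  have "b \<ge> 0" by (simp add: b_def)
  \<comment> \<open>Otherwise \<open>a\<close> would vanish too, and with it
    \<open>\<phi> c\<close>.\<close>
  moreover have "b \<noteq> 0" using val ab \<phi>_pos[OF c] by auto
  ultimately have "b > 0" by simp
  define g where "g = (\<lambda>x. (1 / sqrt b) * f x)"
  have r1: "r \<ge> 1" using k_less by simp
  have "(norm2 (derivI r g))\<^sup>2 = (\<integral>x. ((1 / sqrt b) * derivI r f x)\<^sup>2 \<partial>lebI)"
    unfolding norm2_power2 g_def
  proof (rule integral_cong_AE)
    show "AE x in lebI. (derivI r (\<lambda>x. 1 / sqrt b * f x) x)\<^sup>2 = (1 / sqrt b * derivI r f x)\<^sup>2"
      using L2r_cmult(2)[OF f r1, of "1 / sqrt b"] by eventually_elim simp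
    show "(\<lambda>x. (derivI r (\<lambda>x. 1 / sqrt b * f x) x)\<^sup>2) \<in> borel_measurable lebI"
      using derivI_r_L2[OF L2r_cmult(1)[OF f r1, of "1 / sqrt b"]] by (auto simp: L2_def)
    show "(\<lambda>x. (1 / sqrt b * derivI r f x)\<^sup>2) \<in> borel_measurable lebI"
      using derivI_r_L2[OF f] by (auto simp: L2_def)
  qed
  also have "\<dots> = 1"
    using \<open>b > 0\<close> by (simp add: power_divide b_def[symmetric])
  finally have "norm2 (derivI r g) = 1"
    using norm2_nonneg[of "derivI r g"] by (simp add: power2_eq_1_iff)
  then have gW: "g \<in> W2 r"
    using L2r_cmult(1)[OF f r1, of "1 / sqrt b"] by (simp add: W2_def g_def)
  have "(norm2 g)\<^sup>2 = \<delta>\<^sup>2"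
    using \<open>b > 0\<close> ab by (simp add: norm2_power2 g_def power_divide a_def[symmetric])
  then have g\<delta>: "norm2 g \<le> \<delta>"
    using \<open>\<delta> > 0\<close> norm2_nonneg[of g] by (simp add: power2_eq_iff_nonneg)
  \<comment> \<open>Since \<open>a = \<delta>\<^sup>2 * b\<close>, the energy identity reads
    \<open>\<phi> c = b * (\<delta>\<^sup>2 + \<mu> c)\<close>.\<close>
  have "sqrt (F c) = sqrt ((\<phi> c)\<^sup>2 / b)"
    using \<open>b > 0\<close> unfolding F_def by (intro arg_cong[of _ _ sqrt]) (simp add: val ab power2_eq_square field_simps)
  also have "\<dots> = \<bar>derivI k g (-1)\<bar>"
    using derivI_cmult[OF f k_less, of "-1" "1 / sqrt b"] \<phi>_pos[OF c] \<open>b > 0\<close>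
    by (simp add: g_def fk real_sqrt_divide abs_mult)
  finally have "ennreal (sqrt (F c)) = ennreal \<bar>derivI k g (-1)\<bar>" by simp
  also have "\<dots> \<le> Omega_left k r \<delta>"
    unfolding Omega_left_def by (rule SUP_upper) (use gW g\<delta> in auto)
  finally show ?thesis using c by (auto simp: F_def)
qed

text \<open>For \<delta> = 0 the bound is positive for each \<open>c\<close> and only tends to 0 at
  infinity, so a limit takes the place of the minimizer.\<close>

lemma recovery_error_linear_le_Omega_left:
  assumes "\<delta> \<ge> 0"
  shows "recovery_error linear_maps k r \<delta> \<le> Omega_left k r \<delta>"
proof (cases "\<delta> = 0")
  case True
  have "((\<lambda>c. ennreal (sqrt (\<phi> c * \<mu> c))) \<longlongrightarrow> ennreal (sqrt 0)) at_top"
    by (intro tendsto_ennrealI tendsto_real_sqrt lim_top)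
  then have "recovery_error linear_maps k r \<delta> \<le> ennreal (sqrt 0)"
  proof (rule tendsto_lowerbound)
    show "\<forall>\<^sub>F c in at_top. recovery_error linear_maps k r \<delta> \<le> ennreal (sqrt (\<phi> c * \<mu> c))"
      using eventually_gt_at_top[of 0]
      by eventually_elim (use recovery_error_linear_le[of _ \<delta>] True in simp)
  qed simp
  then show ?thesis by simp
next
  case False
  then obtain c where "c > 0" "ennreal (sqrt (\<phi> c * (\<delta>\<^sup>2 + \<mu> c))) \<le> Omega_left k r \<delta>"
    using Omega_left_ge[of \<delta>] assms by auto
  then show ?thesis
    using recovery_error_linear_le[OF \<open>c > 0\<close> assms] order_trans by blast
qed

text \<open>By continuity an essential bound is a pointwise one: the set where it holds is closed in
  the line and has full measure in the interval, so it contains the open interval and then its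
  closure.\<close>

lemma Omega_left_le_Omega: "Omega_left k r \<delta> \<le> Omega k r \<delta>"
  unfolding Omega_left_def Omega_def
proof (rule SUP_mono)
  fix f assume f: "f \<in> {f \<in> W2 r. norm2 f \<le> \<delta>}"
  then have cont: "continuous_on {-1..1} (derivI k f)"
    using k_less by (intro L2r_continuous_on) (auto simp: W2_def)
  have "ennreal \<bar>derivI k f (-1)\<bar> \<le> norm_inf (derivI k f)"
  proof (rule ccontr)
    assume "\<not> ennreal \<bar>derivI k f (-1)\<bar> \<le> norm_inf (derivI k f)"
    then have less: "norm_inf (derivI k f) < ennreal \<bar>derivI k f (-1)\<bar>" by simp
    then obtain B where B: "norm_inf (derivI k f) = ennreal B" "B \<ge> 0"
      by (cases "norm_inf (derivI k f)") auto
    have gt: "\<bar>derivI k f (-1)\<bar> > B" using less B by (simp add: ennreal_less_iff)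
    have "AE x in lebI. \<bar>derivI k f x\<bar> \<le> B"
      using esssup_AE[of "\<lambda>x. ennreal \<bar>derivI k f x\<bar>" lebI] B by (simp add: norm_inf_def)
    then have AE: "AE x in lebesgue. x \<in> {-1..1} \<longrightarrow> \<bar>derivI k f x\<bar> \<le> B"
      by (subst (asm) AE_restrict_space_iff) auto
    define C where "C = {x \<in> {-1..1}. derivI k f x \<in> {-B..B}}"
    have C: "closed C"
      unfolding C_def by (rule continuous_closed_preimage[OF cont, unfolded vimage_def Int_def mem_Collect_eq]) auto
    have "{-1<..<1} \<subseteq> C"
    proof
      fix x :: real assume x: "x \<in> {-1<..<1}"
      show "x \<in> C"
      proof (rule mem_closed_if_AE_lebesgue_open[OF _ C _ x])
        show "AE x\<in>{-1<..<1} in lebesgue. x \<in> C"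
          using AE by eventually_elim (auto simp: C_def)
      qed simp
    qed
    then have "closure {-1<..<1} \<subseteq> C" using C by (rule closure_minimal)
    then have "-1 \<in> C" by auto
    then show False using gt by (auto simp: C_def)
  qed
  then show "\<exists>g\<in>{f \<in> W2 r. norm2 f \<le> \<delta>}. ennreal \<bar>derivI k f (-1)\<bar> \<le> norm_inf (derivI k g)"
    using f by blast
qed

text \<open>The zero function is admissible data for both \<open>f\<close> and its negative. A
  method returns one answer for both, and that answer cannot be close to both derivatives.\<close>

lemma Omega_le_recovery_error: "Omega k r \<delta> \<le> recovery_error all_maps k r \<delta>"
  unfolding recovery_error_def Omega_def
proof (intro INF_greatest SUP_least)
  fix T f assume T: "T \<in> all_maps" and f: "f \<in> {f \<in> W2 r. norm2 f \<le> \<delta>}"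
  define z :: "real \<Rightarrow> real" where "z = (\<lambda>x. 0)"
  define E where "E = (SUP (f, g)\<in>{(f, g). f \<in> W2 r \<and> g \<in> L2 \<and> norm2 (\<lambda>x. f x - g x) \<le> \<delta>}.
      norm_inf (\<lambda>x. derivI k f x - T g x))"
  have z: "z \<in> L2" by (simp add: z_def L2_def)
  have fr: "f \<in> L2r r" and n: "norm2 (derivI r f) \<le> 1" and f\<delta>: "norm2 f \<le> \<delta>"
    using f by (auto simp: W2_def)
  have r1: "r \<ge> 1" using k_less by simp
  have neg: "(\<lambda>x. - f x) \<in> L2r r" using L2r_cmult(1)[OF fr r1, of "-1"] by simp
  have "norm2 (derivI r (\<lambda>x. - f x)) = norm2 (derivI r f)"
    unfolding norm2_def
  proof (intro arg_cong[of _ _ sqrt] integral_cong_AE)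
    show "AE x in lebI. \<bar>derivI r (\<lambda>x. - f x) x\<bar>\<^sup>2 = \<bar>derivI r f x\<bar>\<^sup>2"
      using L2r_cmult(2)[OF fr r1, of "-1"] by eventually_elim simp
  qed (use derivI_r_L2[OF fr] derivI_r_L2[OF neg] in \<open>auto simp: L2_def\<close>)
  then have negW: "(\<lambda>x. - f x) \<in> W2 r" using n neg by (simp add: W2_def)
  have upper: "norm_inf (\<lambda>x. derivI k h x - T z x) \<le> E" if "h \<in> W2 r" "norm2 h \<le> \<delta>" for h
    unfolding E_def using that z by (intro SUP_upper2[of "(h, z)"]) (auto simp: z_def)
  have Ef: "norm_inf (\<lambda>x. derivI k f x - T z x) \<le> E"
    using f by (intro upper) auto
  have En: "norm_inf (\<lambda>x. derivI k (\<lambda>x. - f x) x - T z x) \<le> E"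
    using negW f\<delta> by (intro upper) (auto simp: norm2_def)
  have sp: "AE x in lebI. x \<in> {-1..1}" by (rule AE_lebI_I)
  have "norm_inf (derivI k f) \<le> E"
    unfolding norm_inf_def
  proof (rule esssup_I)
    show "(\<lambda>x. ennreal \<bar>derivI k f x\<bar>) \<in> borel_measurable lebI"
      using measurable_derivI_k[OF fr] by measurable
    have "AE x in lebI. ennreal \<bar>derivI k f x - T z x\<bar> \<le> E"
      using esssup_AE[of "\<lambda>x. ennreal \<bar>derivI k f x - T z x\<bar>" lebI]
      by eventually_elim (use Ef in \<open>auto simp: norm_inf_def\<close>)
    moreover have "AE x in lebI. ennreal \<bar>derivI k (\<lambda>x. - f x) x - T z x\<bar> \<le> E"
      using esssup_AE[of "\<lambda>x. ennreal \<bar>derivI k (\<lambda>x. - f x) x - T z x\<bar>" lebI]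
      by eventually_elim (use En in \<open>auto simp: norm_inf_def\<close>)
    ultimately show "AE x in lebI. ennreal \<bar>derivI k f x\<bar> \<le> E"
      using sp
    proof eventually_elim
      case (elim x)
      have neg_eq: "derivI k (\<lambda>x. - f x) x = - derivI k f x"
        using derivI_cmult[OF fr k_less elim(3), of "-1"] by simp
      \<comment> \<open>The triangle inequality in pointwise form: whatever the sign of
        \<open>T z x\<close>, one of the two errors is at least the size of the derivative.\<close>
      have "\<bar>derivI k f x\<bar> \<le> \<bar>derivI k f x - T z x\<bar> \<or> \<bar>derivI k f x\<bar> \<le> \<bar>- derivI k f x - T z x\<bar>"
        by linarith
      then show ?case
        using elim(1,2) unfolding neg_eq by (meson ennreal_leI order_trans)
    qed
  qed
  then show "norm_inf (derivI k f) \<le> (SUP (f, g)\<in>{(f, g). f \<in> W2 r \<and> g \<in> L2 \<and> norm2 (\<lambda>x. f x - g x) \<le> \<delta>}.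
      norm_inf (\<lambda>x. derivI k f x - T g x))"
    by (simp add: E_def)
qed

text \<open>The inequalities form a cycle: \<open>Omega\<close>, the error over all maps, the error
  over linear maps, \<open>Omega_left\<close>, and back to \<open>Omega\<close>.\<close>

theorem Omega_eq_recovery_error:
  assumes "\<delta> \<ge> 0" and R: "R = linear_maps \<or> R = all_maps"
  shows "Omega k r \<delta> = recovery_error R k r \<delta> \<and> recovery_error R k r \<delta> = Omega_left k r \<delta>"
proof -
  have "recovery_error all_maps k r \<delta> \<le> recovery_error linear_maps k r \<delta>"
    unfolding recovery_error_def by (rule INF_superset_mono) (auto simp: linear_maps_def)
  then show ?thesis
    using recovery_error_linear_le_Omega_left[OF \<open>\<delta> \<ge> 0\<close>] Omega_left_le_Omega[of \<delta>] Omega_le_recovery_error[of \<delta>] R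
    by (metis antisym order_trans)
qed

end

section \<open>Piecewise smooth representers\<close>

definition glue :: "real \<Rightarrow> (real \<Rightarrow> real) \<Rightarrow> (real \<Rightarrow> real) \<Rightarrow> real \<Rightarrow> real" where
  "glue t u v x = (if x \<le> t then u x else v x)"

text \<open>The disjunction \<open>smooth\<close> serves two uses: with matching slopes a derivative
  everywhere, and with a jump of the slope a derivative at all points except
  \<open>t\<close>.\<close>

lemma has_real_derivative_glue:
  assumes u: "\<And>x. (u has_real_derivative u' x) (at x)" and v: "\<And>x. (v has_real_derivative v' x) (at x)"
    and eq: "u t = v t" and smooth: "x \<noteq> t \<or> u' t = v' t"
  shows "(glue t u v has_real_derivative glue t u' v' x) (at x)"
proof -
  consider "x < t" | "x > t" | "x = t" by linarith
  then show ?thesis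
  proof cases
    case 1
    have "(glue t u v has_real_derivative u' x) (at x)"
      by (rule has_field_derivative_transform_within_open[OF u, of "{..<t}"]) (use 1 in \<open>auto simp: glue_def\<close>)
    then show ?thesis using 1 by (simp add: glue_def)
  next
    case 2
    have "(glue t u v has_real_derivative v' x) (at x)"
      by (rule has_field_derivative_transform_within_open[OF v, of "{t<..}"]) (use 2 in \<open>auto simp: glue_def\<close>)
    then show ?thesis using 2 by (simp add: glue_def)
  next
    case 3
    have "((\<lambda>x. if x \<in> {..t} then u x else v x) has_vector_derivative (if x \<in> {..t} then u' x else v' x))
        (at x within UNIV)"
    proof (rule has_vector_derivative_If_within_closures[where T = "{t<..}"])
      show "(u has_vector_derivative u' x) (at x within S)" "(v has_vector_derivative v' x) (at x within S)" for S
        using u[of x] v[of x]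
        by (auto simp: has_real_derivative_iff_has_vector_derivative[symmetric] intro: has_field_derivative_at_within)
    qed (use 3 eq smooth in auto)
    then show ?thesis
      by (simp add: has_real_derivative_iff_has_vector_derivative glue_def[abs_def])
  qed
qed

lemma glue_L2:
  assumes "continuous_on {-1..1} u" "continuous_on {-1..1} v"
  shows "glue t u v \<in> L2"
proof -
  have [measurable]: "u \<in> borel_measurable lebI" "v \<in> borel_measurable lebI"
    using assms by (auto intro: measurable_lebI_continuous_on)
  have [measurable]: "(\<lambda>x. x) \<in> borel_measurable lebI"
    by (rule measurable_lebI_continuous_on) (rule continuous_on_id)
  obtain A where A: "\<And>x. x \<in> {-1..1} \<Longrightarrow> \<bar>u x\<bar> \<le> A"
    using continuous_on_Icc_bounded[OF assms(1)] by blast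
  obtain B where B: "\<And>x. x \<in> {-1..1} \<Longrightarrow> \<bar>v x\<bar> \<le> B"
    using continuous_on_Icc_bounded[OF assms(2)] by blast
  show ?thesis
  proof (rule L2_bounded)
    show "glue t u v \<in> borel_measurable lebI" unfolding glue_def by measurable
    show "AE x in lebI. \<bar>glue t u v x\<bar> \<le> max A B"
    proof (rule AE_lebI_I)
      show "\<bar>glue t u v x\<bar> \<le> max A B" if "x \<in> {-1..1}" for x
        using A[OF that] B[OF that] by (auto simp: glue_def)
    qed
  qed
qed

lemma abs_cont_on_smooth:
  assumes "\<And>x. (u has_real_derivative u' x) (at x)" "\<And>x. (u' has_real_derivative u'' x) (at x)"
  shows "abs_cont_on a b u"
proof (rule abs_cont_on_C1)
  show "(u has_vector_derivative u' x) (at x within {a..b})" for x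
    using assms(1) by (simp add: has_real_derivative_iff_has_vector_derivative[symmetric] has_field_derivative_at_within)
  show "continuous_on {a..b} u'"
    using assms(2) by (intro continuous_at_imp_continuous_on ballI) (rule DERIV_isCont)
qed

text \<open>The glued function is Lipschitz even if the slope jumps at \<open>t\<close>, because
  each increment splits at \<open>t\<close> into one of \<open>u\<close> and one of
  \<open>v\<close>.\<close>

lemma abs_cont_on_glue:
  assumes u: "\<And>x. (u has_real_derivative u' x) (at x)" "\<And>x. (u' has_real_derivative u'' x) (at x)"
    and v: "\<And>x. (v has_real_derivative v' x) (at x)" "\<And>x. (v' has_real_derivative v'' x) (at x)"
    and eq: "u t = v t"
  shows "abs_cont_on a b (glue t u v)"
proof -
  \<comment> \<open>The interval is enlarged to contain \<open>t\<close>, which need not lie between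
    \<open>a\<close> and \<open>b\<close>.\<close>
  have Lip: "\<exists>M\<ge>0. \<forall>x\<in>{min a t..max b t}. \<forall>y\<in>{min a t..max b t}. \<bar>h y - h x\<bar> \<le> M * \<bar>y - x\<bar>"
    if h: "\<And>x. (h has_real_derivative h' x) (at x)" "\<And>x. (h' has_real_derivative h'' x) (at x)" for h h' h'' :: "real \<Rightarrow> real"
  proof -
    have "continuous_on {min a t..max b t} h'"
      using h(2) by (intro continuous_at_imp_continuous_on ballI) (rule DERIV_isCont)
    then obtain B where B: "\<And>x. x \<in> {min a t..max b t} \<Longrightarrow> \<bar>h' x\<bar> \<le> B"
      using continuous_on_Icc_bounded by blast
    have "\<bar>h y - h x\<bar> \<le> \<bar>B\<bar> * \<bar>y - x\<bar>" if "x \<in> {min a t..max b t}" "y \<in> {min a t..max b t}" for x y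
    proof -
      have "norm (h y - h x) \<le> \<bar>B\<bar> * norm (y - x)"
      proof (rule field_differentiable_bound[where S = "{min a t..max b t}"])
        show "(h has_field_derivative h' z) (at z within {min a t..max b t})" for z
          using h(1) by (rule has_field_derivative_at_within)
        show "norm (h' z) \<le> \<bar>B\<bar>" if "z \<in> {min a t..max b t}" for z
          using B[OF that] by simp
      qed (use that in auto)
      then show ?thesis by simp
    qed
    then show ?thesis by (intro exI[of _ "\<bar>B\<bar>"]) auto
  qed
  obtain M where M: "M \<ge> 0" "\<forall>x\<in>{min a t..max b t}. \<forall>y\<in>{min a t..max b t}. \<bar>u y - u x\<bar> \<le> M * \<bar>y - x\<bar>"
    using Lip[OF u] by blast
  obtain N where N: "N \<ge> 0" "\<forall>x\<in>{min a t..max b t}. \<forall>y\<in>{min a t..max b t}. \<bar>v y - v x\<bar> \<le> N * \<bar>y - x\<bar>"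
    using Lip[OF v] by blast
  show ?thesis
  proof (rule abs_cont_on_Lipschitz)
    fix x y assume xy: "a \<le> x" "x \<le> y" "y \<le> b"
    have "glue t u v y - glue t u v x = (u (min y t) - u (min x t)) + (v (max y t) - v (max x t))"
      using eq xy by (auto simp: glue_def min_def max_def)
    moreover have "\<bar>u (min y t) - u (min x t)\<bar> \<le> M * \<bar>y - x\<bar>"
    proof (rule order_trans[OF M(2)[rule_format]])
      show "M * \<bar>min y t - min x t\<bar> \<le> M * \<bar>y - x\<bar>"
        using M(1) xy by (intro mult_left_mono) auto
    qed (use xy in auto)
    moreover have "\<bar>v (max y t) - v (max x t)\<bar> \<le> N * \<bar>y - x\<bar>"
    proof (rule order_trans[OF N(2)[rule_format]])
      show "N * \<bar>max y t - max x t\<bar> \<le> N * \<bar>y - x\<bar>"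
        using N(1) xy by (intro mult_left_mono) auto
    qed (use xy in auto)
    ultimately show "\<bar>glue t u v y - glue t u v x\<bar> \<le> (M + N) * \<bar>y - x\<bar>"
      using abs_triangle_ineq[of "u (min y t) - u (min x t)" "v (max y t) - v (max x t)"]
      unfolding distrib_right by simp
  qed
qed

section \<open>Integration across the break point\<close>

lemma AE_lebI_neq: "AE x in lebI. x \<noteq> (t::real)"
proof -
  have "AE x in lebesgue. x \<noteq> t"
    by (rule AE_I'[of "{t}"]) auto
  then show ?thesis by (subst AE_restrict_space_iff) (auto elim: eventually_mono)
qed

lemma DERIV_imp_has_vector_derivative_within: "(f has_real_derivative D) (at x) \<Longrightarrow> (f has_vector_derivative D) (at x within S)"
  by (simp add: has_real_derivative_iff_has_vector_derivative[symmetric] has_field_derivative_at_within)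

lemma DERIV_imp_continuous_on: "(\<And>x. (f has_real_derivative f' x) (at x)) \<Longrightarrow> continuous_on S f"
  by (intro continuous_at_imp_continuous_on ballI) (rule DERIV_isCont)

text \<open>The fundamental theorem on either side of \<open>t\<close>. The primitives
  \<open>P\<close> and \<open>Q\<close> may differ at \<open>t\<close>; in the reproducing formulas
  this jump produces the point evaluation.\<close>

lemma integral_lebI_split:
  assumes t: "t \<in> {-1..1}" and q: "integrable lebI q"
    and P: "abs_cont_on (-1) 1 P" and Q: "abs_cont_on (-1) 1 Q"
    and dP: "AE x in lebI. x < t \<longrightarrow> (P has_vector_derivative q x) (at x within {-1..1})"
    and dQ: "AE x in lebI. x > t \<longrightarrow> (Q has_vector_derivative q x) (at x within {-1..1})"
  shows "(\<integral>x. q x \<partial>lebI) = (P t - P (-1)) + (Q 1 - Q t)"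
proof -
  \<comment> \<open>The point \<open>t\<close> goes into the exceptional null set, as neither
    primitive is assumed to have the right derivative there.\<close>
  have "AE x in lebI. x \<noteq> t \<and> (x < t \<longrightarrow> (P has_vector_derivative q x) (at x within {-1..1}))
      \<and> (x > t \<longrightarrow> (Q has_vector_derivative q x) (at x within {-1..1}))"
    using dP dQ AE_lebI_neq[of t] by eventually_elim auto
  then have "AE x in lebesgue. x \<in> {-1..1} \<longrightarrow> x \<noteq> t \<and> (x < t \<longrightarrow> (P has_vector_derivative q x) (at x within {-1..1}))
      \<and> (x > t \<longrightarrow> (Q has_vector_derivative q x) (at x within {-1..1}))"
    by (subst (asm) AE_restrict_space_iff) auto
  then obtain N where N: "N \<in> null_sets lebesgue" and
    der: "{x \<in> space lebesgue. \<not> (x \<in> {-1..1} \<longrightarrow> x \<noteq> t \<and> (x < t \<longrightarrow> (P has_vector_derivative q x) (at x within {-1..1}))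
      \<and> (x > t \<longrightarrow> (Q has_vector_derivative q x) (at x within {-1..1})))} \<subseteq> N"
    unfolding eventually_ae_filter by blast
  have der': "x \<noteq> t \<and> (x < t \<longrightarrow> (P has_vector_derivative q x) (at x within {-1..1}))
      \<and> (x > t \<longrightarrow> (Q has_vector_derivative q x) (at x within {-1..1}))" if "x \<in> {-1..1}" "x \<notin> N" for x
    using der that by auto
  have N': "negligible N" using N by (simp add: negligible_iff_null_sets)
  have 1: "(q has_integral (P t - P (-1))) {-1..t}"
  proof (rule abs_cont_on_has_integral_derivative[OF _ _ N'])
    show "abs_cont_on (-1) t P" by (rule abs_cont_on_subset[OF P]) (use t in auto)
    fix x assume x: "x \<in> {-1..t} - N"
    then have "(P has_vector_derivative q x) (at x within {-1..1})" using der'[of x] t by auto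
    then show "(P has_vector_derivative q x) (at x within {-1..t})"
      by (rule has_vector_derivative_within_subset) (use t in auto)
  qed (use t in auto)
  have 2: "(q has_integral (Q 1 - Q t)) {t..1}"
  proof (rule abs_cont_on_has_integral_derivative[OF _ _ N'])
    show "abs_cont_on t 1 Q" by (rule abs_cont_on_subset[OF Q]) (use t in auto)
    fix x assume x: "x \<in> {t..1} - N"
    then have "(Q has_vector_derivative q x) (at x within {-1..1})" using der'[of x] t by auto
    then show "(Q has_vector_derivative q x) (at x within {t..1})"
      by (rule has_vector_derivative_within_subset) (use t in auto)
  qed (use t in auto)
  have "(q has_integral (P t - P (-1)) + (Q 1 - Q t)) {-1..1}"
    by (rule has_integral_combine[OF _ _ 1 2]) (use t in auto)
  moreover have "(q has_integral (\<integral>x. q x \<partial>lebI)) {-1..1}"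
    using q by (intro has_integral_integral_lebesgue_on) auto
  ultimately show ?thesis by (metis has_integral_unique)
qed

section \<open>Glued functions and their reproducing formulas\<close>

lemma L2r_2D:
  assumes f: "f \<in> L2r 2"
  shows "\<And>x. x \<in> {-1..1} \<Longrightarrow> (f has_vector_derivative derivI 1 f x) (at x within {-1..1})"
    and "AE x in lebI. (derivI 1 f has_vector_derivative derivI 2 f x) (at x within {-1..1})"
    and "abs_cont_on (-1) 1 (derivI 1 f)" "abs_cont_on (-1) 1 f" "f \<in> L2" "derivI 2 f \<in> L2"
proof -
  show 1: "\<And>x. x \<in> {-1..1} \<Longrightarrow> (f has_vector_derivative derivI 1 f x) (at x within {-1..1})"
    using L2rD_differentiable[OF f, of 0] by (simp add: derivI_0)
  show "AE x in lebI. (derivI 1 f has_vector_derivative derivI 2 f x) (at x within {-1..1})"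
    using L2rD_AE_differentiable[OF f] by simp
  show 2: "abs_cont_on (-1) 1 (derivI 1 f)" using f by (simp add: L2r_def)
  show "abs_cont_on (-1) 1 f"
    by (rule abs_cont_on_C1[OF 1 abs_cont_on_imp_continuous_on[OF 2]])
  then show "f \<in> L2" by (intro L2_continuous_on abs_cont_on_imp_continuous_on)
  show "derivI 2 f \<in> L2" using f by (simp add: L2r_def)
qed

lemma L2r_1D:
  assumes f: "f \<in> L2r 1"
  shows "AE x in lebI. (f has_vector_derivative derivI 1 f x) (at x within {-1..1})"
    and "abs_cont_on (-1) 1 f" "f \<in> L2" "derivI 1 f \<in> L2"
proof -
  show "AE x in lebI. (f has_vector_derivative derivI 1 f x) (at x within {-1..1})"
    using L2rD_AE_differentiable[OF f] by (simp add: derivI_0)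
  show "abs_cont_on (-1) 1 f" using f by (simp add: L2r_def derivI_0)
  then show "f \<in> L2" by (intro L2_continuous_on abs_cont_on_imp_continuous_on)
  show "derivI 1 f \<in> L2" using f by (simp add: L2r_def)
qed

lemma glue_L2r_1:
  assumes u: "\<And>x. (u has_real_derivative u' x) (at x)" "\<And>x. (u' has_real_derivative u'' x) (at x)"
    and v: "\<And>x. (v has_real_derivative v' x) (at x)" "\<And>x. (v' has_real_derivative v'' x) (at x)"
    and eq: "u t = v t"
  shows "glue t u v \<in> L2r 1" and "AE x in lebI. derivI 1 (glue t u v) x = glue t u' v' x"
proof -
  have sp: "AE x in lebI. x \<in> {-1..1}" by (rule AE_lebI_I)
  have AE: "AE x in lebI. (glue t u v has_vector_derivative glue t u' v' x) (at x within {-1..1})"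
    using AE_lebI_neq[of t] by eventually_elim (intro DERIV_imp_has_vector_derivative_within has_real_derivative_glue u v eq, simp)
  then show d: "AE x in lebI. derivI 1 (glue t u v) x = glue t u' v' x"
    using sp by eventually_elim (use derivI_Suc_eqI[of _ 0 "glue t u v"] in \<open>simp add: derivI_0\<close>)
  have "glue t u' v' \<in> L2"
    using u(2) v(2) by (intro glue_L2 DERIV_imp_continuous_on)
  then have "derivI 1 (glue t u v) \<in> L2" using d by (rule L2_AE_eqI)
  moreover have "AE x in lebI. glue t u v differentiable (at x within {-1..1})"
    using AE by eventually_elim (rule differentiableI_vector)
  ultimately show "glue t u v \<in> L2r 1"
    using abs_cont_on_glue[OF u v eq] by (simp add: L2r_def derivI_0)
qed

lemma glue_L2r_2:
  assumes u: "\<And>x. (u has_real_derivative u' x) (at x)" "\<And>x. (u' has_real_derivative u'' x) (at x)"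
      "\<And>x. (u'' has_real_derivative u''' x) (at x)"
    and v: "\<And>x. (v has_real_derivative v' x) (at x)" "\<And>x. (v' has_real_derivative v'' x) (at x)"
      "\<And>x. (v'' has_real_derivative v''' x) (at x)"
    and eq: "u t = v t" "u' t = v' t"
  shows "glue t u v \<in> L2r 2"
    and "\<And>x. x \<in> {-1..1} \<Longrightarrow> derivI 1 (glue t u v) x = glue t u' v' x"
    and "AE x in lebI. derivI 2 (glue t u v) x = glue t u'' v'' x"
proof -
  have sp: "AE x in lebI. x \<in> {-1..1}" by (rule AE_lebI_I)
  have h1: "(glue t u v has_vector_derivative glue t u' v' x) (at x within {-1..1})" for x
    using eq by (intro DERIV_imp_has_vector_derivative_within has_real_derivative_glue u v) auto
  show d1: "\<And>x. x \<in> {-1..1} \<Longrightarrow> derivI 1 (glue t u v) x = glue t u' v' x"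
    using derivI_Suc_eqI[of _ 0 "glue t u v"] h1 by (simp add: derivI_0)
  have AE: "AE x in lebI. (derivI 1 (glue t u v) has_vector_derivative glue t u'' v'' x) (at x within {-1..1})"
    using AE_lebI_neq[of t] sp
  proof eventually_elim
    case (elim x)
    have "(glue t u' v' has_vector_derivative glue t u'' v'' x) (at x within {-1..1})"
      using elim(1) by (intro DERIV_imp_has_vector_derivative_within has_real_derivative_glue u v eq) auto
    then show ?case
      by (rule has_vector_derivative_transform[OF elim(2), rotated]) (use d1 in simp)
  qed
  then show d: "AE x in lebI. derivI 2 (glue t u v) x = glue t u'' v'' x"
    using sp by eventually_elim (use derivI_Suc_eqI[of _ 1 "glue t u v"] in \<open>simp add: numeral_2_eq_2\<close>)
  have "glue t u'' v'' \<in> L2"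
    using u(3) v(3) by (intro glue_L2 DERIV_imp_continuous_on)
  then have "derivI 2 (glue t u v) \<in> L2" using d by (rule L2_AE_eqI)
  moreover have "AE x in lebI. derivI 1 (glue t u v) differentiable (at x within {-1..1})"
    using AE by eventually_elim (rule differentiableI_vector)
  moreover have "glue t u v differentiable_on {-1..1}"
    unfolding differentiable_on_def using h1 by (auto intro: differentiableI_vector)
  moreover have "abs_cont_on (-1) 1 (glue t u' v')"
    by (rule abs_cont_on_glue[OF u(2,3) v(2,3) eq(2)])
  then have "abs_cont_on (-1) 1 (derivI 1 (glue t u v))"
    by (rule abs_cont_on_dominated[where M = 1 and g = "glue t u' v'"])
       (use abs_cont_on_glue[OF u(2,3) v(2,3) eq(2)] d1 in auto)
  ultimately show "glue t u v \<in> L2r 2"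
    by (simp add: L2r_def derivI_0)
qed

text \<open>Integration by parts: as \<open>l * h'' = h\<close> on each branch,
  \<open>l * (f * h')\<close> is a primitive of the integrand. The natural boundary conditions
  remove the end terms, and the jump of the slope at \<open>t\<close> remains.\<close>

lemma glue_represents_1:
  assumes u: "\<And>x. (u has_real_derivative u' x) (at x)" "\<And>x. (u' has_real_derivative u x / l) (at x)"
    and v: "\<And>x. (v has_real_derivative v' x) (at x)" "\<And>x. (v' has_real_derivative v x / l) (at x)"
    and eq: "u t = v t" and bc: "u' (-1) = 0" "v' 1 = 0"
    and "l > 0" and t: "t \<in> {-1..1}" and f: "f \<in> L2r 1"
  shows "(\<integral>x. f x * glue t u v x \<partial>lebI) + l * (\<integral>x. derivI 1 f x * derivI 1 (glue t u v) x \<partial>lebI)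
       = l * (u' t - v' t) * f t"
proof -
  note fD = L2r_1D[OF f]
  define w where "w = glue t u v"
  have w: "w \<in> L2r 1" "AE x in lebI. derivI 1 w x = glue t u' v' x"
    unfolding w_def by (rule glue_L2r_1[OF u v eq])+
  define q where "q = (\<lambda>x. f x * w x + l * (derivI 1 f x * derivI 1 w x))"
  have parts: "abs_cont_on (-1) 1 (\<lambda>x. l * (f x * h' x))"
      "AE x in lebI. ((\<lambda>x. l * (f x * h' x)) has_vector_derivative f x * h x + l * (derivI 1 f x * h' x)) (at x within {-1..1})"
    if h: "\<And>x. (h has_real_derivative h' x) (at x)" "\<And>x. (h' has_real_derivative h x / l) (at x)" for h h'
  proof -
    have "(\<lambda>x. h x / l) = (\<lambda>x. (1 / l) * h x)" by auto
    then have h2: "((\<lambda>x. h x / l) has_real_derivative h' x / l) (at x)" for x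
      using DERIV_cmult[OF h(1), of "1 / l" x] by simp
    have "abs_cont_on (-1) 1 (\<lambda>x. f x * h' x)"
      by (intro abs_cont_on_mult fD abs_cont_on_smooth[OF h(2) h2])
    then show "abs_cont_on (-1) 1 (\<lambda>x. l * (f x * h' x))"
      by (rule abs_cont_on_cmult)
    show "AE x in lebI. ((\<lambda>x. l * (f x * h' x)) has_vector_derivative f x * h x + l * (derivI 1 f x * h' x)) (at x within {-1..1})"
      using fD(1)
    proof eventually_elim
      case (elim x)
      have "((\<lambda>x. l * (f x * h' x)) has_vector_derivative l * (f x * (h x / l) + derivI 1 f x * h' x)) (at x within {-1..1})"
        by (intro has_vector_derivative_mult_right has_vector_derivative_mult elim DERIV_imp_has_vector_derivative_within h)
      then show ?case using \<open>l > 0\<close> by (simp add: algebra_simps)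
    qed
  qed
  have int: "integrable lebI (\<lambda>x. f x * w x)" "integrable lebI (\<lambda>x. derivI 1 f x * derivI 1 w x)"
    using L2_integrable_mult fD L2r_1D(3,4)[OF w(1)] by blast+
  have "(\<integral>x. q x \<partial>lebI) = (l * (f t * u' t) - l * (f (-1) * u' (-1))) + (l * (f 1 * v' 1) - l * (f t * v' t))"
  proof (rule integral_lebI_split[OF t _ parts(1)[OF u] parts(1)[OF v]])
    show "integrable lebI q" unfolding q_def using int by auto
    show "AE x in lebI. x < t \<longrightarrow> ((\<lambda>x. l * (f x * u' x)) has_vector_derivative q x) (at x within {-1..1})"
      using parts(2)[OF u] w(2) by eventually_elim (auto simp: q_def w_def glue_def)
    show "AE x in lebI. x > t \<longrightarrow> ((\<lambda>x. l * (f x * v' x)) has_vector_derivative q x) (at x within {-1..1})"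
      using parts(2)[OF v] w(2) by eventually_elim (auto simp: q_def w_def glue_def)
  qed
  moreover have "(\<integral>x. q x \<partial>lebI) = (\<integral>x. f x * w x \<partial>lebI) + l * (\<integral>x. derivI 1 f x * derivI 1 w x \<partial>lebI)"
    unfolding q_def using int by simp
  ultimately show ?thesis using bc by (simp add: w_def algebra_simps)
qed

text \<open>Two integrations by parts: as \<open>l * h'''' = - h\<close> on each branch,
  \<open>l * (f' * h'' - f * h''')\<close> is a primitive of the integrand. A jump of the second
  derivative yields the slope of \<open>f\<close> at \<open>t\<close>, a jump of the third its
  value.\<close>

lemma glue_represents_2:
  assumes u: "\<And>x. (u has_real_derivative u' x) (at x)" "\<And>x. (u' has_real_derivative u'' x) (at x)"
      "\<And>x. (u'' has_real_derivative u''' x) (at x)" "\<And>x. (u''' has_real_derivative - (u x / l)) (at x)"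
    and v: "\<And>x. (v has_real_derivative v' x) (at x)" "\<And>x. (v' has_real_derivative v'' x) (at x)"
      "\<And>x. (v'' has_real_derivative v''' x) (at x)" "\<And>x. (v''' has_real_derivative - (v x / l)) (at x)"
    and eq: "u t = v t" "u' t = v' t"
    and bc: "u'' (-1) = 0" "u''' (-1) = 0" "v'' 1 = 0" "v''' 1 = 0"
    and "l > 0" and t: "t \<in> {-1..1}" and f: "f \<in> L2r 2"
  shows "(\<integral>x. f x * glue t u v x \<partial>lebI) + l * (\<integral>x. derivI 2 f x * derivI 2 (glue t u v) x \<partial>lebI)
       = l * ((u'' t - v'' t) * derivI 1 f t - (u''' t - v''' t) * f t)"
proof -
  note fD = L2r_2D[OF f]
  define w where "w = glue t u v"
  have w: "w \<in> L2r 2" "AE x in lebI. derivI 2 w x = glue t u'' v'' x"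
    unfolding w_def by (rule glue_L2r_2[OF u(1-3) v(1-3) eq])+
  define q where "q = (\<lambda>x. f x * w x + l * (derivI 2 f x * derivI 2 w x))"
  have parts: "abs_cont_on (-1) 1 (\<lambda>x. l * (derivI 1 f x * h'' x - f x * h''' x))"
      "AE x in lebI. ((\<lambda>x. l * (derivI 1 f x * h'' x - f x * h''' x)) has_vector_derivative
         f x * h x + l * (derivI 2 f x * h'' x)) (at x within {-1..1})"
    if h: "\<And>x. (h has_real_derivative h' x) (at x)" "\<And>x. (h' has_real_derivative h'' x) (at x)"
      "\<And>x. (h'' has_real_derivative h''' x) (at x)" "\<And>x. (h''' has_real_derivative - (h x / l)) (at x)"
    for h h' h'' h'''
  proof -
    have "(\<lambda>x. - (h x / l)) = (\<lambda>x. (- 1 / l) * h x)" by auto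
    then have h4: "((\<lambda>x. - (h x / l)) has_real_derivative - (h' x / l)) (at x)" for x
      using DERIV_cmult[OF h(1), of "- 1 / l" x] by simp
    have "abs_cont_on (-1) 1 (\<lambda>x. derivI 1 f x * h'' x - f x * h''' x)"
      by (intro abs_cont_on_diff abs_cont_on_mult fD abs_cont_on_smooth[OF h(3,4)] abs_cont_on_smooth[OF h(4) h4])
    then show "abs_cont_on (-1) 1 (\<lambda>x. l * (derivI 1 f x * h'' x - f x * h''' x))"
      by (rule abs_cont_on_cmult)
    have sp: "AE x in lebI. x \<in> {-1..1}" by (rule AE_lebI_I)
    show "AE x in lebI. ((\<lambda>x. l * (derivI 1 f x * h'' x - f x * h''' x)) has_vector_derivative
         f x * h x + l * (derivI 2 f x * h'' x)) (at x within {-1..1})"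
      using fD(2) sp
    proof eventually_elim
      case (elim x)
      have "((\<lambda>x. l * (derivI 1 f x * h'' x - f x * h''' x)) has_vector_derivative
          l * ((derivI 1 f x * h''' x + derivI 2 f x * h'' x) - (f x * (- (h x / l)) + derivI 1 f x * h''' x))) (at x within {-1..1})"
        by (intro has_vector_derivative_mult_right has_vector_derivative_diff has_vector_derivative_mult elim DERIV_imp_has_vector_derivative_within h fD(1))
      then show ?case using \<open>l > 0\<close> by (simp add: algebra_simps)
    qed
  qed
  have int: "integrable lebI (\<lambda>x. f x * w x)" "integrable lebI (\<lambda>x. derivI 2 f x * derivI 2 w x)"
    using L2_integrable_mult fD L2r_2D(5,6)[OF w(1)] by blast+
  have "(\<integral>x. q x \<partial>lebI)
      = (l * (derivI 1 f t * u'' t - f t * u''' t) - l * (derivI 1 f (-1) * u'' (-1) - f (-1) * u''' (-1)))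
      + (l * (derivI 1 f 1 * v'' 1 - f 1 * v''' 1) - l * (derivI 1 f t * v'' t - f t * v''' t))"
  proof (rule integral_lebI_split[OF t _ parts(1)[OF u] parts(1)[OF v]])
    show "integrable lebI q" unfolding q_def using int by auto
    show "AE x in lebI. x < t \<longrightarrow> ((\<lambda>x. l * (derivI 1 f x * u'' x - f x * u''' x)) has_vector_derivative q x) (at x within {-1..1})"
      using parts(2)[OF u] w(2) by eventually_elim (auto simp: q_def w_def glue_def)
    show "AE x in lebI. x > t \<longrightarrow> ((\<lambda>x. l * (derivI 1 f x * v'' x - f x * v''' x)) has_vector_derivative q x) (at x within {-1..1})"
      using parts(2)[OF v] w(2) by eventually_elim (auto simp: q_def w_def glue_def)
  qed
  moreover have "(\<integral>x. q x \<partial>lebI) = (\<integral>x. f x * w x \<partial>lebI) + l * (\<integral>x. derivI 2 f x * derivI 2 w x \<partial>lebI)"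
    unfolding q_def using int by simp
  ultimately show ?thesis using bc by (simp add: w_def algebra_simps)
qed

section \<open>The three kernels\<close>

text \<open>The identity function lies in between, since \<open>sinh x - x\<close> is
  increasing.\<close>

lemma abs_sin_less_sinh:
  fixes x :: real
  assumes "x > 0"
  shows "\<bar>sin x\<bar> < sinh x"
proof -
  have "(\<lambda>x. sinh x - x) 0 < (\<lambda>x. sinh x - x) x"
  proof (rule DERIV_pos_imp_increasing_open[OF assms])
    fix y :: real assume "0 < y"
    have "((\<lambda>x. sinh x - x) has_real_derivative cosh y - 1) (at y)"
      by (auto intro!: derivative_eq_intros)
    moreover have "cosh y > 1" using \<open>0 < y\<close> cosh_real_strict_mono[of 0 y] by simp
    ultimately show "\<exists>d. ((\<lambda>x. sinh x - x) has_real_derivative d) (at y) \<and> d > 0" by auto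
  qed (auto intro!: continuous_intros)
  then show ?thesis using abs_sin_x_le_abs_x[of x] assms by simp
qed

lemma sin_power2_less_sinh_power2:
  fixes x :: real
  assumes "x > 0"
  shows "(sin x)\<^sup>2 < (sinh x)\<^sup>2"
  using power_strict_mono[OF abs_sin_less_sinh[OF assms] abs_ge_zero, of 2] by simp

lemma abs_sin_cos_less_sinh_cosh:
  fixes x :: real
  assumes "x > 0"
  shows "\<bar>sin x * cos x\<bar> < sinh x * cosh x"
proof -
  have "\<bar>sin x\<bar> * \<bar>cos x\<bar> \<le> \<bar>sin x\<bar> * 1"
    by (intro mult_left_mono) auto
  also have "\<dots> < sinh x * 1" using abs_sin_less_sinh[OF assms] by simp
  also have "\<dots> \<le> sinh x * cosh x"
    using assms cosh_real_ge_1[of x] by (intro mult_left_mono) auto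
  finally show ?thesis by (simp add: abs_mult)
qed

section \<open>The kernel of order one\<close>

text \<open>The Green function of \<open>y - y'' / c\<^sup>2\<close> on [-1,1] with vanishing slope
  at both ends. Writing the right branch as a correction through \<open>max\<close> makes continuity
  in both variables evident.\<close>

definition rod :: "real \<Rightarrow> real \<Rightarrow> real \<Rightarrow> real" where
  "rod c t x = c * (cosh (c * (1 - t)) / sinh (2 * c) * cosh (c * (x + 1)) - sinh (c * max 0 (x - t)))"

lemma rod_glue:
  "rod c t = glue t (\<lambda>x. c * (cosh (c * (1 - t)) / sinh (2 * c) * cosh (c * (x + 1))))
     (\<lambda>x. c * (cosh (c * (1 - t)) / sinh (2 * c) * cosh (c * (x + 1)) - sinh (c * (x - t))))"
  by (rule ext) (auto simp: rod_def glue_def max_def)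

lemma rod_family: "representer_family 1 0 (\<lambda>c. 1 / c\<^sup>2) (\<lambda>c. c * cosh (2 * c) / sinh (2 * c)) rod"
proof
  fix c :: real assume c: "c > 0"
  have S: "sinh (2 * c) > 0" using c by simp
  show "0 < 1 / c\<^sup>2" using c by simp
  show "0 < c * cosh (2 * c) / sinh (2 * c)" using c S by (simp add: cosh_real_pos)
  show "continuous_on UNIV (\<lambda>(t, x). rod c t x)"
    unfolding rod_def case_prod_beta' using S by (intro continuous_intros) auto
  show "\<exists>d. ((\<lambda>c. c * cosh (2 * c) / sinh (2 * c)) has_real_derivative d) (at c)"
    using S by (intro exI) (rule derivative_eq_intros refl | simp)+
  have "((\<lambda>c. 1 / c\<^sup>2) has_real_derivative - 2 / c ^ 3) (at c)"
    using c by (auto intro!: derivative_eq_intros simp: field_simps eval_nat_numeral)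
  then show "\<exists>d. d \<noteq> 0 \<and> ((\<lambda>c. 1 / c\<^sup>2) has_real_derivative d) (at c)"
    using c by (intro exI[of _ "- 2 / c ^ 3"]) auto
  show "derivI 0 (rod c (- 1)) (- 1) = c * cosh (2 * c) / sinh (2 * c)"
    by (simp add: derivI_0 rod_def mult.commute)
  fix t :: real assume t: "t \<in> {-1..1}"
  define K where "K = cosh (c * (1 - t)) / sinh (2 * c)"
  define u where "u = (\<lambda>x. c * (K * cosh (c * (x + 1))))"
  define u' where "u' = (\<lambda>x. c\<^sup>2 * (K * sinh (c * (x + 1))))"
  define v where "v = (\<lambda>x. c * (K * cosh (c * (x + 1)) - sinh (c * (x - t))))"
  define v' where "v' = (\<lambda>x. c\<^sup>2 * (K * sinh (c * (x + 1)) - cosh (c * (x - t))))"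
  have rod: "rod c t = glue t u v" by (simp add: rod_glue u_def v_def K_def)
  have u: "(u has_real_derivative u' x) (at x)" "(u' has_real_derivative u x / (1 / c\<^sup>2)) (at x)" for x
    unfolding u_def u'_def
    by (auto intro!: derivative_eq_intros simp: power2_eq_square algebra_simps)
  have v: "(v has_real_derivative v' x) (at x)" "(v' has_real_derivative v x / (1 / c\<^sup>2)) (at x)" for x
    unfolding v_def v'_def
    by (auto intro!: derivative_eq_intros simp: power2_eq_square algebra_simps)
  have eq: "u t = v t" by (simp add: u_def v_def)
  show "rod c t \<in> L2r 1"
    unfolding rod by (rule glue_L2r_1[OF u v eq])
  \<comment> \<open>The addition formula for \<open>cosh\<close> adds a product of two nonnegative
    hyperbolic sines.\<close>
  have "cosh (c * (1 - t)) * cosh (c * (t + 1)) \<le> cosh (c * (1 - t) + c * (t + 1))"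
    using c t by (simp add: cosh_add)
  also have "c * (1 - t) + c * (t + 1) = 2 * c" by (simp add: algebra_simps)
  finally show "derivI 0 (rod c t) t \<le> c * cosh (2 * c) / sinh (2 * c)"
    using c S by (simp add: derivI_0 rod_def field_simps)
  fix f assume f: "f \<in> L2r 1"
  \<comment> \<open>The slope drops by \<open>c\<^sup>2\<close> at \<open>t\<close>, which the
    weight normalizes to 1.\<close>
  have "(1 / c\<^sup>2) * (u' t - v' t) * f t = f t"
    using c by (simp add: u'_def v'_def algebra_simps)
  moreover have "u' (-1) = 0" by (simp add: u'_def)
  moreover have "v' 1 = 0" using S by (simp add: v'_def K_def mult.commute)
  ultimately show "derivI 0 f t = (\<integral>x. f x * rod c t x \<partial>lebI) + 1 / c\<^sup>2 * (\<integral>x. derivI 1 f x * derivI 1 (rod c t) x \<partial>lebI)"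
    using glue_represents_1[OF u v eq _ _ _ t f] c unfolding rod by (simp add: derivI_0)
\<comment> \<open>What remains is \<open>k_less\<close> and the three limits in
  \<open>c\<close>.\<close>
qed (real_asymp | simp)+

section \<open>Solutions of the beam equation and the kernels of order two\<close>

text \<open>
  The solution of \<open>y'''' + 4 y = 0\<close> with \<open>y(0) = a\<close>, \<open>y'(0) = b\<close>, \<open>y''(0) = g\<close>, \<open>y'''(0) = d\<close>.
\<close>

definition krylov :: "real \<Rightarrow> real \<Rightarrow> real \<Rightarrow> real \<Rightarrow> real \<Rightarrow> real" where
  "krylov a b g d s = a * (cosh s * cos s) + b * ((cosh s * sin s + sinh s * cos s) / 2)
     + g * (sinh s * sin s / 2) + d * ((cosh s * sin s - sinh s * cos s) / 4)"

text \<open>The derivative of a solution is again a solution, and its initial values are the old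
  ones shifted by one place.\<close>

lemma DERIV_krylov [derivative_intros]:
  assumes "(h has_real_derivative h') (at x)"
  shows "((\<lambda>x. krylov a b g d (h x)) has_real_derivative krylov b g d (- 4 * a) (h x) * h') (at x)"
  unfolding krylov_def by (auto intro!: derivative_eq_intros assms simp: field_simps)

lemma krylov_0: "krylov a b g d 0 = a"
  by (simp add: krylov_def)

lemma krylov_minus_4: "krylov (- 4 * a) (- 4 * b) (- 4 * g) (- 4 * d) s = - 4 * krylov a b g d s"
  by (simp add: krylov_def algebra_simps)

lemma continuous_on_krylov [continuous_intros]:
  fixes S :: "'a::t2_space set"
  assumes "continuous_on S a" "continuous_on S b" "continuous_on S g" "continuous_on S d" "continuous_on S h"
  shows "continuous_on S (\<lambda>x. krylov (a x) (b x) (g x) (d x) (h x))"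
  unfolding krylov_def using assms by (intro continuous_intros) auto

text \<open>The determinant of the two-by-two system that the boundary conditions at the right end
  impose on the free coefficients; \<open>s\<close> is the scaled length of the interval.\<close>

definition krylov_det :: "real \<Rightarrow> real" where
  "krylov_det s = (krylov 0 0 1 0 s)\<^sup>2 - krylov 0 1 0 0 s * krylov 0 0 0 1 s"

lemma krylov_det_eq: "krylov_det s = ((sinh s)\<^sup>2 - (sin s)\<^sup>2) / 8"
proof -
  have sq: "cosh s * cosh s = sinh s * sinh s + 1" "cos s * cos s = 1 - sin s * sin s"
    using cosh_square_eq[of s] cos_squared_eq[of s] by (simp_all add: power2_eq_square)
  then have sq': "cosh s * (cosh s * x) = (sinh s * sinh s + 1) * x" "cos s * (cos s * x) = (1 - sin s * sin s) * x" for x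
    by (simp_all add: mult.assoc[symmetric])
  show ?thesis
    by (simp add: krylov_det_def krylov_def field_simps power2_eq_square sq sq')
qed

lemma krylov_det_pos: "s > 0 \<Longrightarrow> krylov_det s > 0"
  using sin_power2_less_sinh_power2[of s] by (simp add: krylov_det_eq)

text \<open>
  The solution of the two natural boundary conditions at the right end point; \<open>A\<close> and \<open>B\<close> are
  the second and third derivatives of the singular part of the Green function there.
\<close>

definition beam_a :: "real \<Rightarrow> real \<Rightarrow> real \<Rightarrow> real" where
  "beam_a s A B = (A * krylov 0 0 1 0 s - B * krylov 0 0 0 1 s) / (4 * krylov_det s)"

definition beam_b :: "real \<Rightarrow> real \<Rightarrow> real \<Rightarrow> real" where
  "beam_b s A B = (B * krylov 0 0 1 0 s - A * krylov 0 1 0 0 s) / (4 * krylov_det s)"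

text \<open>Cramer's rule. The values are negative because the regular part has to cancel the
  singular part at the right end.\<close>

lemma beam_boundary:
  assumes "s > 0"
  shows "krylov 0 0 (- 4 * beam_a s A B) (- 4 * beam_b s A B) s = - A"
    and "krylov 0 (- 4 * beam_a s A B) (- 4 * beam_b s A B) 0 s = - B"
proof -
  have split: "krylov 0 b g d s = b * krylov 0 1 0 0 s + g * krylov 0 0 1 0 s + d * krylov 0 0 0 1 s" for b g d
    by (simp add: krylov_def)
  define X Y Z where "X = krylov 0 1 0 0 s" and "Y = krylov 0 0 1 0 s" and "Z = krylov 0 0 0 1 s"
  have D: "krylov_det s = Y\<^sup>2 - X * Z" by (simp add: krylov_det_def X_def Y_def Z_def)
  have "Y\<^sup>2 - X * Z \<noteq> 0" using krylov_det_pos[OF assms] D by simp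
  then show "krylov 0 0 (- 4 * beam_a s A B) (- 4 * beam_b s A B) s = - A"
    and "krylov 0 (- 4 * beam_a s A B) (- 4 * beam_b s A B) 0 s = - B"
    unfolding split[of _ "- 4 * beam_b s A B"] split[of 0 "- 4 * beam_a s A B"]
    unfolding beam_a_def beam_b_def D X_def[symmetric] Y_def[symmetric] Z_def[symmetric]
    by (simp_all add: divide_simps) (simp_all add: algebra_simps power2_eq_square)
qed

text \<open>A singular part that starts at \<open>t\<close> with zero value and slope, second
  derivative governed by \<open>\<gamma>\<close> and third by \<open>d\<close>, plus a global
  solution with free left end that corrects the right end. The choice \<open>\<gamma> = 0\<close>,
  \<open>d = 1\<close> represents the value at \<open>t\<close>, and \<open>\<gamma> = 1\<close>,
  \<open>d = 0\<close> the slope; \<open>\<kappa>\<close> normalizes.\<close>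

definition beam :: "real \<Rightarrow> real \<Rightarrow> real \<Rightarrow> real \<Rightarrow> real \<Rightarrow> real \<Rightarrow> real" where
  "beam \<kappa> \<gamma> d c t x = \<kappa> * (krylov 0 0 \<gamma> d (c * max 0 (x - t))
     + krylov (beam_a (2 * c) (krylov \<gamma> d 0 0 (c * (1 - t))) (krylov d 0 0 (- 4 * \<gamma>) (c * (1 - t))))
         (beam_b (2 * c) (krylov \<gamma> d 0 0 (c * (1 - t))) (krylov d 0 0 (- 4 * \<gamma>) (c * (1 - t)))) 0 0 (c * (x + 1)))"

lemma continuous_on_beam:
  assumes "c > 0"
  shows "continuous_on UNIV (\<lambda>(t, x). beam \<kappa> \<gamma> d c t x)"
  unfolding beam_def beam_a_def beam_b_def case_prod_beta'
  using krylov_det_pos[of "2 * c"] assms by (intro continuous_intros) auto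

lemma beam_properties:
  fixes \<kappa> \<gamma> d c t :: real
  assumes c: "c > 0" and t: "t \<in> {-1..1}"
  defines "a \<equiv> beam_a (2 * c) (krylov \<gamma> d 0 0 (c * (1 - t))) (krylov d 0 0 (- 4 * \<gamma>) (c * (1 - t)))"
    and "b \<equiv> beam_b (2 * c) (krylov \<gamma> d 0 0 (c * (1 - t))) (krylov d 0 0 (- 4 * \<gamma>) (c * (1 - t)))"
  shows "beam \<kappa> \<gamma> d c t \<in> L2r 2"
    and "beam \<kappa> \<gamma> d c t t = \<kappa> * krylov a b 0 0 (c * (t + 1))"
    and "derivI 1 (beam \<kappa> \<gamma> d c t) t = \<kappa> * c * krylov b 0 0 (- 4 * a) (c * (t + 1))"
    and "f \<in> L2r 2 \<Longrightarrow> (\<integral>x. f x * beam \<kappa> \<gamma> d c t x \<partial>lebI)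
          + 1 / (4 * c ^ 4) * (\<integral>x. derivI 2 f x * derivI 2 (beam \<kappa> \<gamma> d c t) x \<partial>lebI)
        = \<kappa> / (4 * c\<^sup>2) * (c * d * f t - \<gamma> * derivI 1 f t)"
proof -
  define u where "u = (\<lambda>x. \<kappa> * krylov a b 0 0 (c * (x + 1)))"
  define u' where "u' = (\<lambda>x. \<kappa> * c * krylov b 0 0 (- 4 * a) (c * (x + 1)))"
  define u'' where "u'' = (\<lambda>x. \<kappa> * c\<^sup>2 * krylov 0 0 (- 4 * a) (- 4 * b) (c * (x + 1)))"
  define u''' where "u''' = (\<lambda>x. \<kappa> * c ^ 3 * krylov 0 (- 4 * a) (- 4 * b) 0 (c * (x + 1)))"
  define z where "z = (\<lambda>x. \<kappa> * krylov 0 0 \<gamma> d (c * (x - t)))"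
  define z' where "z' = (\<lambda>x. \<kappa> * c * krylov 0 \<gamma> d 0 (c * (x - t)))"
  define z'' where "z'' = (\<lambda>x. \<kappa> * c\<^sup>2 * krylov \<gamma> d 0 0 (c * (x - t)))"
  define z''' where "z''' = (\<lambda>x. \<kappa> * c ^ 3 * krylov d 0 0 (- 4 * \<gamma>) (c * (x - t)))"
  \<comment> \<open>Four derivatives in \<open>x\<close> multiply a branch by
    \<open>- 4 * c ^ 4\<close>, which is \<open>- 1 / l\<close>.\<close>
  define l where "l = 1 / (4 * c ^ 4)"
  have "l > 0" using c by (simp add: l_def)
  have u: "(u has_real_derivative u' x) (at x)" "(u' has_real_derivative u'' x) (at x)"
      "(u'' has_real_derivative u''' x) (at x)" for x
    unfolding u_def u'_def u''_def u'''_def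
    by (auto intro!: derivative_eq_intros simp: power2_eq_square power3_eq_cube)
  have z: "(z has_real_derivative z' x) (at x)" "(z' has_real_derivative z'' x) (at x)"
      "(z'' has_real_derivative z''' x) (at x)" for x
    unfolding z_def z'_def z''_def z'''_def
    by (auto intro!: derivative_eq_intros simp: power2_eq_square power3_eq_cube)
  have u4: "(u''' has_real_derivative - (u x / l)) (at x)" for x
  proof -
    have "(u''' has_real_derivative \<kappa> * c ^ 3 * (krylov (- 4 * a) (- 4 * b) (- 4 * 0) (- 4 * 0) (c * (x + 1)) * c)) (at x)"
      unfolding u'''_def by (auto intro!: derivative_eq_intros)
    then show ?thesis unfolding krylov_minus_4 by (simp add: u_def l_def eval_nat_numeral ac_simps)
  qed
  have z4: "(z''' has_real_derivative - (z x / l)) (at x)" for x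
  proof -
    have "(z''' has_real_derivative \<kappa> * c ^ 3 * (krylov (- 4 * 0) (- 4 * 0) (- 4 * \<gamma>) (- 4 * d) (c * (x - t)) * c)) (at x)"
      unfolding z'''_def by (auto intro!: derivative_eq_intros)
    then show ?thesis unfolding krylov_minus_4 by (simp add: z_def l_def eval_nat_numeral ac_simps)
  qed
  \<comment> \<open>Both branches contain \<open>u\<close>, so every jump at \<open>t\<close> comes
    from \<open>z\<close> alone.\<close>
  define v where "v = (\<lambda>x. u x + z x)"
  define v' where "v' = (\<lambda>x. u' x + z' x)"
  define v'' where "v'' = (\<lambda>x. u'' x + z'' x)"
  define v''' where "v''' = (\<lambda>x. u''' x + z''' x)"
  have v: "(v has_real_derivative v' x) (at x)" "(v' has_real_derivative v'' x) (at x)"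
      "(v'' has_real_derivative v''' x) (at x)" for x
    unfolding v_def v'_def v''_def v'''_def by (intro DERIV_add u z)+
  have v4: "(v''' has_real_derivative - (v x / l)) (at x)" for x
    using DERIV_add[OF u4[of x] z4[of x]] by (simp add: v_def v'''_def add_divide_distrib)
  have eq: "u t = v t" "u' t = v' t"
    by (simp_all add: v_def v'_def z_def z'_def krylov_0)
  have beam: "beam \<kappa> \<gamma> d c t = glue t u v"
    by (rule ext)
       (auto simp: beam_def a_def b_def glue_def u_def v_def z_def max_def krylov_0 distrib_left)
  note glue = glue_L2r_2[OF u v eq]
  show "beam \<kappa> \<gamma> d c t \<in> L2r 2" unfolding beam by (rule glue(1))
  show "beam \<kappa> \<gamma> d c t t = \<kappa> * krylov a b 0 0 (c * (t + 1))"
    unfolding beam by (simp add: glue_def u_def)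
  show "derivI 1 (beam \<kappa> \<gamma> d c t) t = \<kappa> * c * krylov b 0 0 (- 4 * a) (c * (t + 1))"
    unfolding beam glue(2)[OF t] by (simp add: glue_def u'_def)
  assume f: "f \<in> L2r 2"
  have two: "c * (1 + 1) = 2 * c" by simp
  have bc: "u'' (-1) = 0" "u''' (-1) = 0" "v'' 1 = 0" "v''' 1 = 0"
    using beam_boundary[of "2 * c"] c
    unfolding v''_def v'''_def u''_def u'''_def z''_def z'''_def two a_def b_def
    by (simp_all add: krylov_0)
  have "(\<integral>x. f x * beam \<kappa> \<gamma> d c t x \<partial>lebI) + l * (\<integral>x. derivI 2 f x * derivI 2 (beam \<kappa> \<gamma> d c t) x \<partial>lebI)
      = l * ((u'' t - v'' t) * derivI 1 f t - (u''' t - v''' t) * f t)"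
    unfolding beam by (rule glue_represents_2[OF u u4 v v4 eq bc \<open>l > 0\<close> t f])
  also have "\<dots> = \<kappa> / (4 * c\<^sup>2) * (c * d * f t - \<gamma> * derivI 1 f t)"
    using c by (simp add: v''_def v'''_def z''_def z'''_def krylov_0 l_def field_simps eval_nat_numeral)
  finally show "(\<integral>x. f x * beam \<kappa> \<gamma> d c t x \<partial>lebI)
          + 1 / (4 * c ^ 4) * (\<integral>x. derivI 2 f x * derivI 2 (beam \<kappa> \<gamma> d c t) x \<partial>lebI)
        = \<kappa> / (4 * c\<^sup>2) * (c * d * f t - \<gamma> * derivI 1 f t)"
    by (simp add: l_def)
qed

section \<open>Diagonal values of the kernels of order two\<close>

text \<open>Bounds the oscillating terms of the diagonal identities. The absolute value covers both
  signs with which they occur there.\<close>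

lemma sin_cos_term_le:
  fixes p q :: real
  assumes "p \<ge> 0" "q \<ge> 0"
  shows "\<bar>sin p * cos p * ((sinh q)\<^sup>2 + 3 * (sin q)\<^sup>2)\<bar> \<le> sinh p * cosh p * (3 * (sinh q)\<^sup>2 + (sin q)\<^sup>2)"
proof -
  have "\<bar>sin p * cos p\<bar> \<le> sinh p * cosh p"
    using abs_sin_cos_less_sinh_cosh[of p] assms(1) by (cases "p = 0") auto
  moreover have "(sin q)\<^sup>2 \<le> (sinh q)\<^sup>2"
    using sin_power2_less_sinh_power2[of q] assms(2) by (cases "q = 0") auto
  then have "\<bar>(sinh q)\<^sup>2 + 3 * (sin q)\<^sup>2\<bar> \<le> 3 * (sinh q)\<^sup>2 + (sin q)\<^sup>2" by simp
  ultimately show ?thesis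
    unfolding abs_mult[of "sin p * cos p"] using assms(1) by (intro mult_mono) auto
qed

text \<open>With \<open>p\<close> and \<open>q\<close> the scaled distances from \<open>t\<close> to
  the two ends, the left sides are, up to a positive factor, the end point value minus the diagonal
  value of the two kernels. The right sides are nonnegative by \<open>sin_cos_term_le\<close> and
  vanish for \<open>p = 0\<close>.\<close>

lemma krylov_diag_identities:
  fixes p q :: real
  defines "T r \<equiv> sinh r * cosh r" and "\<tau> r \<equiv> sin r * cos r"
  shows "2 * (T (p + q) - \<tau> (p + q))
      - 8 * (krylov 0 0 1 0 (p + q) * (krylov 1 0 0 0 p * krylov 0 1 0 0 q + krylov 0 1 0 0 p * krylov 1 0 0 0 q)
         - krylov 0 0 0 1 (p + q) * krylov 1 0 0 0 p * krylov 1 0 0 0 q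
         - krylov 0 1 0 0 (p + q) * krylov 0 1 0 0 p * krylov 0 1 0 0 q)
    = T p * (3 * (sinh q)\<^sup>2 + (sin q)\<^sup>2) + \<tau> p * ((sinh q)\<^sup>2 + 3 * (sin q)\<^sup>2)
      + (T q * (3 * (sinh p)\<^sup>2 + (sin p)\<^sup>2) + \<tau> q * ((sinh p)\<^sup>2 + 3 * (sin p)\<^sup>2))" (is ?thesis1)
  and "2 * (T (p + q) + \<tau> (p + q))
      - 4 * (krylov 0 1 0 0 (p + q) * krylov 1 0 0 0 p * krylov 1 0 0 0 q
         + 4 * krylov 0 0 1 0 (p + q) * (krylov 1 0 0 0 p * krylov 0 0 0 1 q + krylov 0 0 0 1 p * krylov 1 0 0 0 q)
         + 16 * krylov 0 0 0 1 (p + q) * krylov 0 0 0 1 p * krylov 0 0 0 1 q)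
    = T p * (3 * (sinh q)\<^sup>2 + (sin q)\<^sup>2) - \<tau> p * ((sinh q)\<^sup>2 + 3 * (sin q)\<^sup>2)
      + (T q * (3 * (sinh p)\<^sup>2 + (sin p)\<^sup>2) - \<tau> q * ((sinh p)\<^sup>2 + 3 * (sin p)\<^sup>2))" (is ?thesis2)
proof -
  define S C s c where "S = sinh p" and "C = cosh p" and "s = sin p" and "c = cos p"
  define S' C' s' c' where "S' = sinh q" and "C' = cosh q" and "s' = sin q" and "c' = cos q"
  note fold = S_def[symmetric] C_def[symmetric] s_def[symmetric] c_def[symmetric]
    S'_def[symmetric] C'_def[symmetric] s'_def[symmetric] c'_def[symmetric]
  have sq: "C * C = S * S + 1" "c * c = 1 - s * s" "C' * C' = S' * S' + 1" "c' * c' = 1 - s' * s'"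
    unfolding S_def C_def s_def c_def S'_def C'_def s'_def c'_def
    using cosh_square_eq[of p] cos_squared_eq[of p] cosh_square_eq[of q] cos_squared_eq[of q]
    by (simp_all add: power2_eq_square)
  then have sq': "C * (C * x) = (S * S + 1) * x" "c * (c * x) = (1 - s * s) * x"
     "C' * (C' * x) = (S' * S' + 1) * x" "c' * (c' * x) = (1 - s' * s') * x" for x
    by (simp_all add: mult.assoc[symmetric])
  show ?thesis1
    unfolding T_def \<tau>_def krylov_def sinh_add cosh_add sin_add cos_add fold
    by (simp add: field_simps power2_eq_square sq sq')
  show ?thesis2
    unfolding T_def \<tau>_def krylov_def sinh_add cosh_add sin_add cos_add fold
    by (simp add: field_simps power2_eq_square sq sq')
qed

lemma krylov_split:
  "krylov a b g d s = a * krylov 1 0 0 0 s + b * krylov 0 1 0 0 s + g * krylov 0 0 1 0 s + d * krylov 0 0 0 1 s"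
  by (simp add: krylov_def)

lemma inverse_quartic_derivative: "c > 0 \<Longrightarrow> \<exists>d. d \<noteq> 0 \<and> ((\<lambda>c. 1 / (4 * c ^ 4)) has_real_derivative d) (at c)" for c :: real
proof -
  assume c: "c > 0"
  have "((\<lambda>c. 1 / (4 * c ^ 4)) has_real_derivative - 1 / c ^ 5) (at c)"
    using c by (auto intro!: derivative_eq_intros simp: field_simps eval_nat_numeral)
  then show "\<exists>d. d \<noteq> 0 \<and> ((\<lambda>c. 1 / (4 * c ^ 4)) has_real_derivative d) (at c)"
    using c by (intro exI[of _ "- 1 / c ^ 5"]) auto
qed

lemma beam_family_0:
  "representer_family 2 0 (\<lambda>c. 1 / (4 * c ^ 4))
     (\<lambda>c. 2 * c * (sinh (2 * c) * cosh (2 * c) - sin (2 * c) * cos (2 * c)) / ((sinh (2 * c))\<^sup>2 - (sin (2 * c))\<^sup>2))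
     (\<lambda>c. beam (4 * c) 0 1 c)"
proof
  fix c :: real assume c: "c > 0"
  define E where "E = (sinh (2 * c))\<^sup>2 - (sin (2 * c))\<^sup>2"
  have E: "E > 0" using sin_power2_less_sinh_power2[of "2 * c"] c by (simp add: E_def)
  have det: "4 * krylov_det (2 * c) = E / 2" by (simp add: krylov_det_eq E_def)
  show "0 < 1 / (4 * c ^ 4)" using c by simp
  show "\<exists>d. d \<noteq> 0 \<and> ((\<lambda>c. 1 / (4 * c ^ 4)) has_real_derivative d) (at c)"
    by (rule inverse_quartic_derivative[OF c])
  \<comment> \<open>The denominator \<open>E / 2\<close> of the coefficients turns the prefactor
    \<open>4 * c\<close> into \<open>8 * c\<close>.\<close>
  have diag: "beam (4 * c) 0 1 c t t = 8 * c * (krylov 0 0 1 0 (2 * c)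
        * (krylov 1 0 0 0 (c * (t + 1)) * krylov 0 1 0 0 (c * (1 - t)) + krylov 0 1 0 0 (c * (t + 1)) * krylov 1 0 0 0 (c * (1 - t)))
      - krylov 0 0 0 1 (2 * c) * krylov 1 0 0 0 (c * (t + 1)) * krylov 1 0 0 0 (c * (1 - t))
      - krylov 0 1 0 0 (2 * c) * krylov 0 1 0 0 (c * (t + 1)) * krylov 0 1 0 0 (c * (1 - t))) / E"
    if "t \<in> {-1..1}" for t
    unfolding beam_properties(2)[OF c that] beam_a_def beam_b_def det krylov_split[of "_ / _"]
    using E by (simp add: field_simps)
  \<comment> \<open>At the left end \<open>p = 0\<close>, and the diagonal identity becomes an
    equality between the two values.\<close>
  have left: "beam (4 * c) 0 1 c (-1) (-1) = 2 * c * (sinh (2 * c) * cosh (2 * c) - sin (2 * c) * cos (2 * c)) / E"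
    using diag[of "-1"] arg_cong[OF krylov_diag_identities(1)[of 0 "2 * c"], of "\<lambda>x. c * x"] E
    by (simp add: krylov_0 field_simps)
  show "derivI 0 (beam (4 * c) 0 1 c (- 1)) (- 1)
      = 2 * c * (sinh (2 * c) * cosh (2 * c) - sin (2 * c) * cos (2 * c)) / ((sinh (2 * c))\<^sup>2 - (sin (2 * c))\<^sup>2)"
    using left by (simp add: derivI_0 E_def)
  have "sin (2 * c) * cos (2 * c) < sinh (2 * c) * cosh (2 * c)"
    using abs_sin_cos_less_sinh_cosh[of "2 * c"] c by linarith
  then show "0 < 2 * c * (sinh (2 * c) * cosh (2 * c) - sin (2 * c) * cos (2 * c)) / ((sinh (2 * c))\<^sup>2 - (sin (2 * c))\<^sup>2)"
    using c E by (simp add: E_def)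
  show "continuous_on UNIV (\<lambda>(t, x). beam (4 * c) 0 1 c t x)"
    by (rule continuous_on_beam[OF c])
  show "\<exists>d. ((\<lambda>c. 2 * c * (sinh (2 * c) * cosh (2 * c) - sin (2 * c) * cos (2 * c)) / ((sinh (2 * c))\<^sup>2 - (sin (2 * c))\<^sup>2))
      has_real_derivative d) (at c)"
    using E unfolding E_def by (intro exI) (rule derivative_eq_intros refl | simp)+
  fix t :: real assume t: "t \<in> {-1..1}"
  show "beam (4 * c) 0 1 c t \<in> L2r 2" by (rule beam_properties(1)[OF c t])
  define p q where "p = c * (t + 1)" and "q = c * (1 - t)"
  have pq: "p \<ge> 0" "q \<ge> 0" using c t by (auto simp: p_def q_def)
  have sum: "p + q = 2 * c" by (simp add: p_def q_def algebra_simps)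
  have "8 * (krylov 0 0 1 0 (p + q) * (krylov 1 0 0 0 p * krylov 0 1 0 0 q + krylov 0 1 0 0 p * krylov 1 0 0 0 q)
         - krylov 0 0 0 1 (p + q) * krylov 1 0 0 0 p * krylov 1 0 0 0 q
         - krylov 0 1 0 0 (p + q) * krylov 0 1 0 0 p * krylov 0 1 0 0 q)
       \<le> 2 * (sinh (p + q) * cosh (p + q) - sin (p + q) * cos (p + q))"
    using krylov_diag_identities(1)[of p q] sin_cos_term_le[OF pq] sin_cos_term_le[OF pq(2,1)] by linarith
  then have "c * (8 * (krylov 0 0 1 0 (p + q) * (krylov 1 0 0 0 p * krylov 0 1 0 0 q + krylov 0 1 0 0 p * krylov 1 0 0 0 q)
         - krylov 0 0 0 1 (p + q) * krylov 1 0 0 0 p * krylov 1 0 0 0 q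
         - krylov 0 1 0 0 (p + q) * krylov 0 1 0 0 p * krylov 0 1 0 0 q)) / E
       \<le> c * (2 * (sinh (p + q) * cosh (p + q) - sin (p + q) * cos (p + q))) / E"
    using c E by (intro divide_right_mono mult_left_mono) auto
  then show "derivI 0 (beam (4 * c) 0 1 c t) t
      \<le> 2 * c * (sinh (2 * c) * cosh (2 * c) - sin (2 * c) * cos (2 * c)) / ((sinh (2 * c))\<^sup>2 - (sin (2 * c))\<^sup>2)"
    using diag[OF t] unfolding sum E_def[symmetric] p_def[symmetric] q_def[symmetric]
    by (simp add: derivI_0 ac_simps)
  fix f assume f: "f \<in> L2r 2"
  show "derivI 0 f t = (\<integral>x. f x * beam (4 * c) 0 1 c t x \<partial>lebI)
      + 1 / (4 * c ^ 4) * (\<integral>x. derivI 2 f x * derivI 2 (beam (4 * c) 0 1 c t) x \<partial>lebI)"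
    unfolding beam_properties(4)[OF c t f] using c by (simp add: derivI_0 power2_eq_square)
qed (real_asymp | simp)+

lemma beam_family_1:
  "representer_family 2 1 (\<lambda>c. 1 / (4 * c ^ 4))
     (\<lambda>c. 4 * c ^ 3 * (sinh (2 * c) * cosh (2 * c) + sin (2 * c) * cos (2 * c)) / ((sinh (2 * c))\<^sup>2 - (sin (2 * c))\<^sup>2))
     (\<lambda>c. beam (- 4 * c\<^sup>2) 1 0 c)"
proof
  fix c :: real assume c: "c > 0"
  define E where "E = (sinh (2 * c))\<^sup>2 - (sin (2 * c))\<^sup>2"
  have E: "E > 0" using sin_power2_less_sinh_power2[of "2 * c"] c by (simp add: E_def)
  have det: "4 * krylov_det (2 * c) = E / 2" by (simp add: krylov_det_eq E_def)
  show "0 < 1 / (4 * c ^ 4)" using c by simp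
  show "\<exists>d. d \<noteq> 0 \<and> ((\<lambda>c. 1 / (4 * c ^ 4)) has_real_derivative d) (at c)"
    by (rule inverse_quartic_derivative[OF c])
  \<comment> \<open>Here the third derivative of the singular part carries a factor -4; the signs it
    brings in cancel against the negative \<open>\<kappa>\<close>, and only plus signs
    remain.\<close>
  have diag: "derivI 1 (beam (- 4 * c\<^sup>2) 1 0 c t) t = 8 * c ^ 3 * (krylov 0 1 0 0 (2 * c) * krylov 1 0 0 0 (c * (t + 1)) * krylov 1 0 0 0 (c * (1 - t))
      + 4 * krylov 0 0 1 0 (2 * c) * (krylov 1 0 0 0 (c * (t + 1)) * krylov 0 0 0 1 (c * (1 - t)) + krylov 0 0 0 1 (c * (t + 1)) * krylov 1 0 0 0 (c * (1 - t)))
      + 16 * krylov 0 0 0 1 (2 * c) * krylov 0 0 0 1 (c * (t + 1)) * krylov 0 0 0 1 (c * (1 - t))) / E"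
    if "t \<in> {-1..1}" for t
    unfolding beam_properties(3)[OF c that] beam_a_def beam_b_def det krylov_split[of "_ / _"] krylov_split[of 0 0 0 "- 4 * 1"]
    using E by (simp add: field_simps eval_nat_numeral)
  have left: "derivI 1 (beam (- 4 * c\<^sup>2) 1 0 c (-1)) (-1) = 4 * c ^ 3 * (sinh (2 * c) * cosh (2 * c) + sin (2 * c) * cos (2 * c)) / E"
    using diag[of "-1"] arg_cong[OF krylov_diag_identities(2)[of 0 "2 * c"], of "\<lambda>x. 2 * c ^ 3 * x"] E
    by (simp add: krylov_0 field_simps)
  then show "derivI 1 (beam (- 4 * c\<^sup>2) 1 0 c (- 1)) (- 1)
      = 4 * c ^ 3 * (sinh (2 * c) * cosh (2 * c) + sin (2 * c) * cos (2 * c)) / ((sinh (2 * c))\<^sup>2 - (sin (2 * c))\<^sup>2)"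
    by (simp add: E_def)
  have "0 < sinh (2 * c) * cosh (2 * c) + sin (2 * c) * cos (2 * c)"
    using abs_sin_cos_less_sinh_cosh[of "2 * c"] c by linarith
  then show "0 < 4 * c ^ 3 * (sinh (2 * c) * cosh (2 * c) + sin (2 * c) * cos (2 * c)) / ((sinh (2 * c))\<^sup>2 - (sin (2 * c))\<^sup>2)"
    using c E by (simp add: E_def)
  show "continuous_on UNIV (\<lambda>(t, x). beam (- 4 * c\<^sup>2) 1 0 c t x)"
    by (rule continuous_on_beam[OF c])
  show "\<exists>d. ((\<lambda>c. 4 * c ^ 3 * (sinh (2 * c) * cosh (2 * c) + sin (2 * c) * cos (2 * c)) / ((sinh (2 * c))\<^sup>2 - (sin (2 * c))\<^sup>2))
      has_real_derivative d) (at c)"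
    using E unfolding E_def by (intro exI) (rule derivative_eq_intros refl | simp)+
  fix t :: real assume t: "t \<in> {-1..1}"
  show "beam (- 4 * c\<^sup>2) 1 0 c t \<in> L2r 2" by (rule beam_properties(1)[OF c t])
  define p q where "p = c * (t + 1)" and "q = c * (1 - t)"
  have pq: "p \<ge> 0" "q \<ge> 0" using c t by (auto simp: p_def q_def)
  have sum: "p + q = 2 * c" by (simp add: p_def q_def algebra_simps)
  have "4 * (krylov 0 1 0 0 (p + q) * krylov 1 0 0 0 p * krylov 1 0 0 0 q
         + 4 * krylov 0 0 1 0 (p + q) * (krylov 1 0 0 0 p * krylov 0 0 0 1 q + krylov 0 0 0 1 p * krylov 1 0 0 0 q)
         + 16 * krylov 0 0 0 1 (p + q) * krylov 0 0 0 1 p * krylov 0 0 0 1 q)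
       \<le> 2 * (sinh (p + q) * cosh (p + q) + sin (p + q) * cos (p + q))"
    using krylov_diag_identities(2)[of p q] sin_cos_term_le[OF pq] sin_cos_term_le[OF pq(2,1)] by linarith
  then have "2 * c ^ 3 * (4 * (krylov 0 1 0 0 (p + q) * krylov 1 0 0 0 p * krylov 1 0 0 0 q
         + 4 * krylov 0 0 1 0 (p + q) * (krylov 1 0 0 0 p * krylov 0 0 0 1 q + krylov 0 0 0 1 p * krylov 1 0 0 0 q)
         + 16 * krylov 0 0 0 1 (p + q) * krylov 0 0 0 1 p * krylov 0 0 0 1 q)) / E
       \<le> 2 * c ^ 3 * (2 * (sinh (p + q) * cosh (p + q) + sin (p + q) * cos (p + q))) / E"
    using c E by (intro divide_right_mono mult_left_mono) auto
  then show "derivI 1 (beam (- 4 * c\<^sup>2) 1 0 c t) t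
      \<le> 4 * c ^ 3 * (sinh (2 * c) * cosh (2 * c) + sin (2 * c) * cos (2 * c)) / ((sinh (2 * c))\<^sup>2 - (sin (2 * c))\<^sup>2)"
    using diag[OF t] unfolding sum E_def[symmetric] p_def[symmetric] q_def[symmetric]
    by (simp add: algebra_simps add_divide_distrib)
  fix f assume f: "f \<in> L2r 2"
  show "derivI 1 f t = (\<integral>x. f x * beam (- 4 * c\<^sup>2) 1 0 c t x \<partial>lebI)
      + 1 / (4 * c ^ 4) * (\<integral>x. derivI 2 f x * derivI 2 (beam (- 4 * c\<^sup>2) 1 0 c t) x \<partial>lebI)"
    unfolding beam_properties(4)[OF c t f] using c by simp
qed (real_asymp | simp)+

theorem theorem7:
  fixes r k :: nat and \<delta> :: real
    and R :: "((real \<Rightarrow> real) \<Rightarrow> real \<Rightarrow> real) set"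
  assumes "(r = 1 \<and> k = 0) \<or> (r = 2 \<and> k \<in> {0, 1})"
    and "R = linear_maps \<or> R = all_maps"
    and "\<delta> \<ge> 0"
  shows "Omega k r \<delta> = recovery_error R k r \<delta> \<and> recovery_error R k r \<delta> = Omega_left k r \<delta>"
  using assms(1)
proof (elim disjE conjE)
  assume "r = 1" "k = 0"
  then show ?thesis
    using representer_family.Omega_eq_recovery_error[OF rod_family assms(3,2)] by simp
next
  assume "r = 2" "k \<in> {0, 1}"
  then show ?thesis
    using representer_family.Omega_eq_recovery_error[OF beam_family_0 assms(3,2)]
      representer_family.Omega_eq_recovery_error[OF beam_family_1 assms(3,2)] by auto
qed

end
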